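(* Let $K\ge0$ be an integer and $\gamma_0=1,\gamma_1,\dots,\gamma_K$ real numbers. Let $p_n(x)=\sum_{j=0}^K\gamma_j\mathcal{B}_{n-j}(x)$, where $\mathcal{B}_i(x)=\sum_{k=0}^iS(i,k)x^k$ is the $i$-th Bell polynomial and $\mathcal{B}_i=0$ for $i<0$. Let $P(x)=\sum_{j=0}^K\gamma_jx^{K-j}$ and assume $P(m)\neq0$ for every positive integer $m$. Let $\mathcal{H}=\{l\in\mathbb{Z}_{>0}: P(l)P(l+1)<0\}=\{h_1<h_2<\dots<h_{s_{\mathcal H}}\}$ (with $s_{\mathcal H}$ its number of elements) and $\mathcal{G}=\mathbb{Z}_{>0}\setminus\mathcal{H}=\{g_1<g_2<\cdots\}$. Then there exists $n_0$ such that for $n\ge n_0$ the polynomial $p_n$ has exactly $s_{\mathcal H}$ positive zeros, all simple. Writing $\xi_m^+(n)$, $1\le m\le s_{\mathcal H}$, for the positive zeros of $p_n$ in increasing order and $\xi_m^-(n)$ for the negative zeros of $p_n$ in decreasing order (counted with multiplicity), we have $$\lim_{n\to\infty}\frac{\xi_m^+(n)}{-\frac{h_mP(h_m)}{P(h_m+1)}\left(\frac{h_m}{h_m+1}\right)^{n-K-1}}=1,\quad1\le m\le s_{\mathcal H},$$ $$\lim_{n\to\infty}\frac{\xi_m^-(n)}{-\frac{g_mP(g_m)}{P(g_m+1)}\left(\frac{g_m}{g_m+1}\right)^{n-K-1}}=1,\quad m\ge1.$$ Moreover, for any positive integer $m$, $n_0$ can be chosen so that for $n\ge n_0$ the $m$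 rightmost negative zeros of $p_n$ are simple.
   Context: $S(i,k)$ denote the Stirling numbers of the second kind, $S(i,k)=\sum_{t=0}^k\frac{(-1)^{k-t}t^i}{(k-t)!\,t!}$. *)

theory Defs
  imports
    Complex_Main
    "HOL-Library.Infinite_Set"
    "HOL-Combinatorics.Stirling"
    "HOL-Computational_Algebra.Polynomial"
begin

text \<open>
  The library defines the Stirling numbers of the second kind by their recurrence. Lemma
  \<open>Stirling_explicit\<close> below identifies them with the explicit formula.
\<close>

definition Stirling_summand :: "nat \<Rightarrow> nat \<Rightarrow> nat \<Rightarrow> real" where
  "Stirling_summand i k t = (-1) ^ (k - t) * real t ^ i / (fact (k - t) * fact t)"

lemma sum_Stirling_summand_0: "(\<Sum>t\<le>Suc k. Stirling_summand 0 (Suc k) t) = 0"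
proof -
  have "(\<Sum>t\<le>Suc k. Stirling_summand 0 (Suc k) t) =
        (\<Sum>t\<le>Suc k. of_nat (Suc k choose t) * 1 ^ t * (-1) ^ (Suc k - t)) / fact (Suc k)"
    unfolding sum_divide_distrib
  proof (rule sum.cong[OF refl])
    fix t assume "t \<in> {..Suc k}"
    then have "t \<le> Suc k" by simp
    from binomial_fact[OF this, where 'a = real]
    show "Stirling_summand 0 (Suc k) t = of_nat (Suc k choose t) * 1 ^ t * (-1) ^ (Suc k - t) / fact (Suc k)"
      by (simp del: fact_Suc add: mult.commute Stirling_summand_def)
  qed
  also have "\<dots> = (1 + (-1::real)) ^ Suc k / fact (Suc k)"
    by (simp only: binomial_ring)
  finally show ?thesis by simp
qed

lemma Stirling_summand_Suc:
  assumes "t \<le> k"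
  shows "Stirling_summand (Suc n) (Suc k) t = real (Suc k) * Stirling_summand n (Suc k) t + Stirling_summand n k t"
proof -
    obtain d where k: "k = t + d" using assms le_Suc_ex by blast
    have "real t = real (Suc k) - real (Suc d)" by (simp add: k)
    then have "Stirling_summand (Suc n) (Suc k) t = (real (Suc k) - real (Suc d)) * Stirling_summand n (Suc k) t"
      by (simp add: Stirling_summand_def)
    moreover have "real (Suc d) * Stirling_summand n (Suc k) t = - Stirling_summand n k t"
    proof -
      have "Suc k - t = Suc d" "k - t = d" using k by auto
      then show ?thesis by (simp add: Stirling_summand_def del: of_nat_Suc)
    qed
    ultimately show ?thesis by (simp only: left_diff_distrib)
qed

lemma sum_Stirling_summand_Suc: "(\<Sum>t\<le>Suc k. Stirling_summand (Suc n) (Suc k) t) = real (Suc k) * (\<Sum>t\<le>Suc k. Stirling_summand n (Suc k) t) + (\<Sum>t\<le>k. Stirling_summand n k t)"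
proof -
  have "Stirling_summand (Suc n) (Suc k) (Suc k) = real (Suc k) * Stirling_summand n (Suc k) (Suc k)" by (simp add: Stirling_summand_def)
  moreover have "(\<Sum>t\<le>k. Stirling_summand (Suc n) (Suc k) t) = real (Suc k) * (\<Sum>t\<le>k. Stirling_summand n (Suc k) t) + (\<Sum>t\<le>k. Stirling_summand n k t)"
    by (simp only: sum_distrib_left flip: sum.distrib) (intro sum.cong refl Stirling_summand_Suc, simp)
  ultimately show ?thesis by (simp only: sum.atMost_Suc distrib_left)
qed

lemma Stirling_explicit: "real (Stirling i k) = (\<Sum>t\<le>k. Stirling_summand i k t)"
proof (induction i k rule: Stirling.induct)
  case 1 then show ?case by (simp add: Stirling_summand_def)
next
  case (2 k) show ?case by (simp only: sum_Stirling_summand_0 Stirling.simps of_nat_0)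
next
  case (3 n) then show ?case by (simp add: Stirling_summand_def)
next
  case (4 n k) then show ?case
    by (simp only: sum_Stirling_summand_Suc Stirling.simps of_nat_add of_nat_mult)
qed

definition bell_poly :: "nat \<Rightarrow> real poly" where
  "bell_poly i = (\<Sum>k\<le>i. monom (real (Stirling i k)) k)"

text \<open>
  The case distinction implements the convention that Bell polynomials of negative index vanish
  (subtraction on natural numbers truncates).
\<close>

definition bell_comb :: "nat \<Rightarrow> (nat \<Rightarrow> real) \<Rightarrow> nat \<Rightarrow> real poly" where
  "bell_comb K \<gamma> n = (\<Sum>j\<le>K. smult (\<gamma> j) (if j \<le> n then bell_poly (n - j) else 0))"

text \<open>
  The zeros are listed with multiplicity. Indexing starts at 1, so that \<open>pos_zero q m\<close> is
  the \<open>m\<close>-th positive zero in increasing order and \<open>neg_zero q m\<close> the \<open>m\<close>-th negative zero in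
  decreasing order; both are meaningful only for \<open>m\<close> between 1 and the length of the list.
\<close>

definition pos_zeros :: "real poly \<Rightarrow> real list" where
  "pos_zeros q = sorted_list_of_multiset (filter_mset (\<lambda>x. x > 0) (proots q))"

definition neg_zeros :: "real poly \<Rightarrow> real list" where
  "neg_zeros q = rev (sorted_list_of_multiset (filter_mset (\<lambda>x. x < 0) (proots q)))"

definition pos_zero :: "real poly \<Rightarrow> nat \<Rightarrow> real" where
  "pos_zero q m = pos_zeros q ! (m - 1)"

definition neg_zero :: "real poly \<Rightarrow> nat \<Rightarrow> real" where
  "neg_zero q m = neg_zeros q ! (m - 1)"

end

theory Submission
  imports Defs
begin

text \<open>
  Put \<open>N = n - K\<close>. By Dobinski's formula, \<open>F x = exp x * p\<^sub>n x\<close> is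
  \<open>\<Sum>t. a\<^sub>t * x ^ t\<close> with \<open>a\<^sub>t = t ^ N * P t / t!\<close>. Since \<open>ln\<close> is strictly
  concave, for large \<open>N\<close> and \<open>\<bar>x\<bar>\<close> comparable to \<open>\<bar>y\<^sub>m\<bar>\<close>, where
  \<open>y\<^sub>m = - a\<^sub>m / a\<^sub>m\<^sub>+\<^sub>1\<close>, all terms but those of index \<open>m\<close> and
  \<open>m + 1\<close> are negligible, so \<open>F x / (a\<^sub>m * x ^ m)\<close> is close to
  \<open>1 - x / y\<^sub>m\<close> and there is exactly one zero, simple and asymptotic to \<open>y\<^sub>m\<close>.
  Between \<open>4 * \<bar>y\<^sub>m\<bar>\<close> and \<open>\<bar>y\<^sub>m\<^sub>+\<^sub>1\<bar> / 4\<close> the term of index \<open>m + 1\<close>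
  dominates and there is none; for large positive \<open>x\<close> there is none because \<open>P t > 0\<close> for
  all large \<open>t\<close>. The zero near \<open>y\<^sub>m\<close> is positive precisely when \<open>m\<close> lies in \<open>H\<close>.
\<close>

section \<open>A Dobinski formula for Bell polynomials\<close>

text \<open>The factor \<open>fact k * (t choose k)\<close> is the falling factorial of
  \<open>t\<close> with \<open>k\<close> factors. Multiplying it by \<open>t = (t - k) + k\<close>
  reproduces the Stirling recurrence.\<close>

lemma power_eq_sum_Stirling:
  "t ^ i = (\<Sum>k\<le>i. Stirling i k * (fact k * (t choose k)))"
proof (induction i)
  case 0
  then show ?case by simp
next
  case (Suc i)
  let ?f = "\<lambda>k. fact k * (t choose k)"
  have step: "t * ?f k = ?f (Suc k) + k * ?f k" for k
  proof (cases "k \<le> t")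
    case True
    have "Suc k * (t choose Suc k) = (t - k) * (t choose k)"
      by (metis binomial_absorb_comp binomial_absorption)
    then have "?f (Suc k) = (t - k) * ?f k"
      by (simp only: fact_Suc of_nat_id mult.assoc mult.left_commute)
    then show ?thesis
      using True by (metis add.commute distrib_right le_add_diff_inverse)
  qed (simp add: binomial_eq_0)
  have "t ^ Suc i = (\<Sum>k\<le>i. Stirling i k * ?f (Suc k)) + (\<Sum>k\<le>i. k * Stirling i k * ?f k)"
    unfolding power_Suc Suc sum_distrib_left sum.distrib[symmetric]
  proof (rule sum.cong[OF refl])
    fix k
    have "t * (Stirling i k * ?f k) = Stirling i k * (t * ?f k)" by (simp only: ac_simps)
    then show "t * (Stirling i k * ?f k) = Stirling i k * ?f (Suc k) + k * Stirling i k * ?f k"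
      by (simp only: step) (simp only: distrib_left ac_simps)
  qed
  also have "(\<Sum>k\<le>i. k * Stirling i k * ?f k) = (\<Sum>k\<le>Suc i. k * Stirling i k * ?f k)"
    by simp
  also have "\<dots> = (\<Sum>k\<le>i. Suc k * Stirling i (Suc k) * ?f (Suc k))"
    by (simp only: sum.atMost_Suc_shift mult_0 add_0_left)
  also have "(\<Sum>k\<le>i. Stirling i k * ?f (Suc k)) + \<dots> =
      (\<Sum>k\<le>i. Stirling (Suc i) (Suc k) * ?f (Suc k))"
    by (simp only: sum.distrib[symmetric] Stirling.simps(4) distrib_right add.commute)
  also have "\<dots> = (\<Sum>k\<le>Suc i. Stirling (Suc i) k * ?f k)"
    by (simp only: sum.atMost_Suc_shift Stirling.simps(3) mult_0 add_0_left)
  finally show ?case .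
qed

text \<open>A falling factorial divided by \<open>fact t\<close> is \<open>1 / fact (t - k)\<close>,
  so the series is \<open>x ^ k\<close> times the exponential series, shifted by
  \<open>k\<close>.\<close>

lemma exp_times_power_sums:
  "(\<lambda>t. real (fact k * (t choose k)) * x ^ t / fact t) sums (exp x * x ^ k)"
    (is "?f sums _")
proof -
  have shift: "?f (s + k) = x ^ k * (x ^ s / fact s)" for s
  proof -
    have "real (fact k * (s + k choose k)) = fact (s + k) / fact s"
      using binomial_fact[of k "s + k", where 'a = real] by simp
    then show ?thesis
      by (simp add: power_add del: of_nat_mult)
  qed
  have "(\<lambda>s. x ^ s / fact s) sums exp x"
    using exp_converges[of x] by (simp add: divide_inverse mult.commute)
  then have "(\<lambda>s. ?f (s + k)) sums (x ^ k * exp x)"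
    unfolding shift by (rule sums_mult)
  moreover have "(\<Sum>t<k. ?f t) = 0" by (simp add: binomial_eq_0)
  ultimately show ?thesis
    using sums_iff_shift[of ?f k "x ^ k * exp x"] by (simp only: add_0_right mult.commute)
qed

lemma Dobinski: "(\<lambda>t. real t ^ i * x ^ t / fact t) sums (exp x * poly (bell_poly i) x)"
proof -
  have "(\<lambda>t. \<Sum>k\<le>i. real (Stirling i k) * (real (fact k * (t choose k)) * x ^ t / fact t)) sums
      (\<Sum>k\<le>i. real (Stirling i k) * (exp x * x ^ k))"
    by (intro sums_sum sums_mult exp_times_power_sums)
  moreover have "real t ^ i = (\<Sum>k\<le>i. real (Stirling i k) * real (fact k * (t choose k)))" for t
    by (simp only: power_eq_sum_Stirling[of t i] of_nat_sum of_nat_mult flip: of_nat_power)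
  ultimately show ?thesis
    by (simp add: bell_poly_def poly_sum poly_monom sum_distrib_left sum_distrib_right
        sum_divide_distrib ac_simps)
qed

text \<open>The Stirling recurrence read coefficientwise. It means that x d/dx maps
  \<open>exp x * poly (bell_poly i) x\<close> to the same function with index
  \<open>Suc i\<close>.\<close>

lemma bell_poly_Suc: "bell_poly (Suc i) = pCons 0 (bell_poly i + pderiv (bell_poly i))"
proof (rule poly_eqI)
  have coeff: "coeff (bell_poly i) k = real (Stirling i k)" for i k
    by (simp add: bell_poly_def coeff_sum)
  show "coeff (bell_poly (Suc i)) n = coeff (pCons 0 (bell_poly i + pderiv (bell_poly i))) n" for n
    by (cases n) (simp_all add: coeff coeff_pderiv algebra_simps)
qed

lemma summable_power_div_fact:
  fixes c :: real
  shows "summable (\<lambda>t. real t ^ i * c ^ t / fact t)"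
  using Dobinski by (rule sums_summable)

section \<open>Concentration of the series on two consecutive terms\<close>

text \<open>The left side is \<open>(1 + (s + 2) * d) / (1 + d) ^ (s + 2)\<close>, and Bernoulli's
  inequality bounds it by its value at \<open>s = 0\<close>. This value is below 1 and independent
  of \<open>s\<close>, so its \<open>N\<close>-th power can be taken out of an infinite sum.\<close>

lemma ratio_above_less:
  fixes m s :: nat
  assumes "m > 0"
  defines "d \<equiv> 1 / real m"
  shows "real (m + (s + 2)) / real m * (real m / real (m + 1)) ^ (s + 2) \<le> (1 + 2 * d) / (1 + d)\<^sup>2"
proof -
  have d: "d > 0" using assms by simp
  have "1 + real (s + 2) * d \<le> (1 + 2 * d) * (1 + real s * d)"
    using d by (simp add: algebra_simps)
  also have "\<dots> \<le> (1 + 2 * d) * (1 + d) ^ s"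
    using d Bernoulli_inequality[of d s] by (intro mult_left_mono) (auto simp: mult.commute)
  finally have "(1 + real (s + 2) * d) / (1 + d) ^ (s + 2) \<le> (1 + 2 * d) * (1 + d) ^ s / (1 + d) ^ (s + 2)"
    using d by (intro divide_right_mono) auto
  also have "\<dots> = (1 + 2 * d) / (1 + d)\<^sup>2"
    using d by (simp add: power_add power2_eq_square)
  finally have *: "(1 + real (s + 2) * d) / (1 + d) ^ (s + 2) \<le> (1 + 2 * d) / (1 + d)\<^sup>2" .
  have "real m / real (m + 1) = 1 / (1 + d)" "real (m + (s + 2)) / real m = 1 + real (s + 2) * d"
    using assms by (simp_all add: field_simps)
  then show ?thesis
    using * by (simp only: power_divide power_one times_divide_eq_right mult_1_right)
qed

text \<open>With \<open>t = m - s\<close> and \<open>d = 1 / m\<close>, Bernoulli's inequality gives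
  \<open>1 - s * d \<le> (1 - d) ^ s\<close>, and the product with \<open>(1 + d) ^ s\<close> is
  \<open>(1 - d * d) ^ s\<close>, below 1.\<close>

lemma ratio_below_less:
  fixes m t :: nat
  assumes "0 < t" "t < m"
  shows "real t / real m * (real (m + 1) / real m) ^ (m - t) < 1"
proof -
  define d where "d = 1 / real m"
  define s where "s = m - t"
  have d: "0 < d" "d < 1" and s: "s > 0" using assms by (auto simp: d_def s_def)
  have "real t / real m = 1 - real s * d"
    using assms by (simp add: d_def s_def of_nat_diff field_simps)
  also have "\<dots> \<le> (1 - d) ^ s"
    using Bernoulli_inequality[of "- d" s] d by (simp add: mult.commute)
  finally have "real t / real m * (1 + d) ^ s \<le> (1 - d) ^ s * (1 + d) ^ s"
    using d by (intro mult_right_mono) auto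
  also have "\<dots> = (1 - d * d) ^ s"
    by (simp add: power_mult_distrib[symmetric] algebra_simps)
  also have "\<dots> < 1"
    using d s mult_le_one[of d d] by (subst power_less_one_iff) auto
  finally show ?thesis
    using assms by (simp add: d_def s_def add_divide_distrib add.commute)
qed

text \<open>Collects the dependence on \<open>N\<close> in a single \<open>N\<close>-th power. With
  \<open>D * u ^ N\<close> a multiple of |\<open>y m N\<close>| or of its reciprocal, each term
  relative to that of index \<open>m\<close> becomes a geometric sequence in
  \<open>N\<close>.\<close>

lemma scaled_term:
  fixes X M u D c f g p r w :: real
  assumes "X \<ge> 0" "M \<ge> 0" "f > 0" "g > 0"
  shows "w * \<bar>X ^ N * p / f\<bar> * (D * u ^ N) ^ k / \<bar>M ^ N * r / g\<bar> =
    (X / M * u ^ k) ^ N * (g / \<bar>r\<bar>) * (w * (\<bar>p\<bar> / f) * D ^ k)"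
proof -
  have "(u ^ N) ^ k = (u ^ k) ^ N" by (metis power_mult mult.commute)
  then show ?thesis
    using assms by (simp add: abs_mult abs_divide power_mult_distrib power_divide mult_ac)
qed

text \<open>In the application \<open>q N\<close> is the combination of index \<open>N + K\<close>
  and \<open>P\<close> is restricted to natural numbers. By \<open>q_Suc\<close>, x d/dx turns
  \<open>exp x * poly (q N) x\<close> into the function for \<open>Suc N\<close>, so derivatives
  stay within the family.\<close>

locale coefficient_family =
  fixes P :: "nat \<Rightarrow> real" and q :: "nat \<Rightarrow> real poly"
  assumes P_nz: "t > 0 \<Longrightarrow> P t \<noteq> 0"
    and P_summable: "c > 0 \<Longrightarrow> summable (\<lambda>t. real t ^ i * \<bar>P t\<bar> * c ^ t / fact t)"
    and q_sums: "(\<lambda>t. real t ^ N * P t / fact t * x ^ t) sums (exp x * poly (q N) x)"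
    and q_Suc: "q (Suc N) = pCons 0 (q N + pderiv (q N))"
begin

definition a :: "nat \<Rightarrow> nat \<Rightarrow> real" where
  "a N t = real t ^ N * P t / fact t"

text \<open>The terms of index \<open>m\<close> and \<open>Suc m\<close> of \<open>\<Sum>t. a N t * x ^ t\<close> cancel exactly at \<open>x = y m N\<close>.\<close>

definition y :: "nat \<Rightarrow> nat \<Rightarrow> real" where
  "y m N = - (a N m / a N (Suc m))"

text \<open>
  Sizes of the remaining terms relative to the term of index \<open>m\<close>. The factor \<open>t + m\<close>
  covers the series of \<open>F x = exp x * poly (q N) x\<close> (weights \<open>1\<close>) as well as that of
  \<open>x * F' x - m * F x\<close> (weights \<open>t - m\<close>).
\<close>

definition above :: "nat \<Rightarrow> real \<Rightarrow> nat \<Rightarrow> real" where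
  "above m r N = (\<Sum>s. real (s + m + 2 + m) * \<bar>a N (s + m + 2)\<bar> * r ^ (s + 2)) / \<bar>a N m\<bar>"

definition below :: "nat \<Rightarrow> real \<Rightarrow> nat \<Rightarrow> real" where
  "below m r N = (\<Sum>t=1..<m. real (t + m) * \<bar>a N t\<bar> / r ^ (m - t)) / \<bar>a N m\<bar>"

lemma a_nz: "t > 0 \<Longrightarrow> a N t \<noteq> 0"
  by (simp add: a_def P_nz)

lemma a_0: "N > 0 \<Longrightarrow> a N 0 = 0"
  by (simp add: a_def)

lemma y_nz: "m > 0 \<Longrightarrow> y m N \<noteq> 0"
  by (simp add: y_def a_nz)

lemma y_eq: "m > 0 \<Longrightarrow> y m N = - (real (m + 1) * P m / P (m + 1)) * (real m / real (m + 1)) ^ N"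
  using P_nz[of "Suc m"] by (simp add: y_def a_def power_divide divide_simps)

lemma abs_a_times: "m > 0 \<Longrightarrow> \<bar>a N (Suc m)\<bar> * \<bar>y m N\<bar> = \<bar>a N m\<bar>"
  using a_nz[of "Suc m" N] by (simp add: y_def abs_divide)

lemma summable_a:
  assumes "r \<ge> 0"
  shows "summable (\<lambda>t. (real t + c) * \<bar>a N t\<bar> * r ^ t)"
proof -
  \<comment> \<open>Passing from \<open>r\<close> to \<open>r + 1\<close> covers
    \<open>r = 0\<close>, as \<open>P_summable\<close> asks for a positive base.\<close>
  have "summable (\<lambda>t. real t ^ Suc N * \<bar>P t\<bar> * (r + 1) ^ t / fact t + \<bar>c\<bar> * (real t ^ N * \<bar>P t\<bar> * (r + 1) ^ t / fact t))"
    using assms by (intro summable_add summable_mult P_summable) auto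
  moreover have "norm ((real t + c) * \<bar>a N t\<bar> * r ^ t) \<le>
      real t ^ Suc N * \<bar>P t\<bar> * (r + 1) ^ t / fact t + \<bar>c\<bar> * (real t ^ N * \<bar>P t\<bar> * (r + 1) ^ t / fact t)" for t
  proof -
    have "norm ((real t + c) * \<bar>a N t\<bar> * r ^ t) = \<bar>real t + c\<bar> * (\<bar>a N t\<bar> * r ^ t)"
      using assms by (simp add: abs_mult)
    also have "\<dots> \<le> (real t + \<bar>c\<bar>) * (\<bar>a N t\<bar> * (r + 1) ^ t)"
      using assms by (intro mult_mono power_mono) auto
    finally show ?thesis by (simp add: a_def abs_mult algebra_simps add_divide_distrib)
  qed
  ultimately show ?thesis
    by (rule summable_comparison_test'[where N = 0])
qed

lemma summable_above:
  assumes "r \<ge> 0"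
  shows "summable (\<lambda>s. real (s + m + 2 + m) * \<bar>a N (s + m + 2)\<bar> * r ^ (s + 2))"
proof (cases "r = 0")
  case False
  have "summable (\<lambda>s. (real (s + (m + 2)) + real m) * \<bar>a N (s + (m + 2))\<bar> * r ^ (s + (m + 2)))"
    using summable_a[OF assms, of "real m" N]
    by (subst summable_iff_shift)
  then have "summable (\<lambda>s. ((real (s + (m + 2)) + real m) * \<bar>a N (s + (m + 2))\<bar> * r ^ (s + (m + 2))) / r ^ m)"
    by (rule summable_divide)
  then show ?thesis
    using False by (simp add: power_add add_ac mult_ac)
qed simp

text \<open>At a radius proportional to |\<open>y m N\<close>|, each summand is at most
  \<open>\<rho> ^ N\<close> times a constant multiple of \<open>C s\<close>, which is free of
  \<open>N\<close>, with \<open>\<rho> < 1\<close> from \<open>ratio_above_less\<close>. As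
  \<open>C\<close> is summable, the whole sum decays like \<open>\<rho> ^ N\<close>.\<close>

lemma above_tendsto:
  assumes "m > 0" "c > 0"
  shows "(\<lambda>N. above m (c * \<bar>y m N\<bar>) N) \<longlonglongrightarrow> 0"
proof -
  define d where "d = 1 / real m"
  define \<rho> where "\<rho> = (1 + 2 * d) / (1 + d)\<^sup>2"
  define D where "D = c * (real (m + 1) * \<bar>P m\<bar> / \<bar>P (m + 1)\<bar>)"
  define C where "C = (\<lambda>s. real (s + m + 2 + m) * (\<bar>P (s + m + 2)\<bar> / fact (s + m + 2)) * D ^ (s + 2))"
  have D: "D > 0" using assms P_nz by (simp add: D_def)
  have d: "d > 0" using assms by (simp add: d_def)
  then have \<rho>: "\<rho> < 1" "\<rho> > 0" by (simp_all add: \<rho>_def power2_eq_square divide_simps) (simp_all add: algebra_simps)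
  have sumC: "summable C"
    using summable_above[of D m 0] D by (simp add: C_def a_def abs_mult)
  have term_le: "real (s + m + 2 + m) * \<bar>a N (s + m + 2)\<bar> * (c * \<bar>y m N\<bar>) ^ (s + 2) / \<bar>a N m\<bar>
      \<le> \<rho> ^ N * (fact m / \<bar>P m\<bar>) * C s" for s N
  proof -
    have y: "c * \<bar>y m N\<bar> = D * (real m / real (m + 1)) ^ N"
      using assms by (simp add: y_eq D_def abs_mult abs_divide)
    have "real (s + m + 2 + m) * \<bar>a N (s + m + 2)\<bar> * (c * \<bar>y m N\<bar>) ^ (s + 2) / \<bar>a N m\<bar> =
      (real (m + (s + 2)) / real m * (real m / real (m + 1)) ^ (s + 2)) ^ N * (fact m / \<bar>P m\<bar>) * C s"
      unfolding y C_def a_def by (subst scaled_term) (simp_all add: add_ac)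
    also have "\<dots> \<le> \<rho> ^ N * (fact m / \<bar>P m\<bar>) * C s"
    proof (intro mult_right_mono power_mono)
      show "real (m + (s + 2)) / real m * (real m / real (m + 1)) ^ (s + 2) \<le> \<rho>"
        using ratio_above_less[OF assms(1)] unfolding \<rho>_def d_def .
      show "0 \<le> C s" using D by (simp add: C_def)
    qed simp_all
    finally show ?thesis .
  qed
  have bound: "above m (c * \<bar>y m N\<bar>) N \<le> \<rho> ^ N * (fact m / \<bar>P m\<bar>) * suminf C" for N
  proof -
    have "above m (c * \<bar>y m N\<bar>) N =
        (\<Sum>s. real (s + m + 2 + m) * \<bar>a N (s + m + 2)\<bar> * (c * \<bar>y m N\<bar>) ^ (s + 2) / \<bar>a N m\<bar>)"
      unfolding above_def using assms by (intro suminf_divide[symmetric] summable_above) auto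
    also have "\<dots> \<le> (\<Sum>s. \<rho> ^ N * (fact m / \<bar>P m\<bar>) * C s)"
      using assms by (intro suminf_le term_le summable_divide summable_above summable_mult sumC) simp
    also have "\<dots> = \<rho> ^ N * (fact m / \<bar>P m\<bar>) * suminf C"
      by (rule suminf_mult[OF sumC])
    finally show ?thesis .
  qed
  have nonneg: "0 \<le> above m (c * \<bar>y m N\<bar>) N" for N
    unfolding above_def using assms by (intro divide_nonneg_nonneg suminf_nonneg summable_above) auto
  have "(\<lambda>N. \<rho> ^ N * (fact m / \<bar>P m\<bar>) * suminf C) \<longlonglongrightarrow> 0 * (fact m / \<bar>P m\<bar>) * suminf C"
    using \<rho> by (intro tendsto_mult tendsto_const LIMSEQ_power_zero) auto
  then have lim: "(\<lambda>N. \<rho> ^ N * (fact m / \<bar>P m\<bar>) * suminf C) \<longlonglongrightarrow> 0" by simp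
  show ?thesis
    by (rule tendsto_sandwich[OF _ _ tendsto_const lim]) (intro always_eventually allI bound nonneg)+
qed

text \<open>The sum is finite, so decay of each term suffices: it is a constant times the
  \<open>N\<close>-th power of the ratio in \<open>ratio_below_less\<close>.\<close>

lemma below_tendsto:
  assumes "m > 0" "c > 0"
  shows "(\<lambda>N. below m (c * \<bar>y m N\<bar>) N) \<longlonglongrightarrow> 0"
proof -
  define D where "D = c * (real (m + 1) * \<bar>P m\<bar> / \<bar>P (m + 1)\<bar>)"
  have "(\<lambda>N. real (t + m) * \<bar>a N t\<bar> / (c * \<bar>y m N\<bar>) ^ (m - t) / \<bar>a N m\<bar>) \<longlonglongrightarrow> 0" if "t \<in> {1..<m}" for t
  proof -
    define C where "C = real (t + m) * (\<bar>P t\<bar> / fact t) / D ^ (m - t) * (fact m / \<bar>P m\<bar>)"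
    have "real (t + m) * \<bar>a N t\<bar> / (c * \<bar>y m N\<bar>) ^ (m - t) / \<bar>a N m\<bar> =
        (real t / real m * (real (m + 1) / real m) ^ (m - t)) ^ N * C" for N
    proof -
      have y: "c * \<bar>y m N\<bar> = D * (real m / real (m + 1)) ^ N"
        using assms by (simp add: y_eq D_def abs_mult abs_divide)
      show ?thesis
        using scaled_term[of "real t" "real m" "fact t" "fact m" "real (t + m)" N "P t" "1 / D" "real (m + 1) / real m" "m - t" "P m"]
        unfolding y C_def a_def
        by (simp add: power_divide power_mult_distrib mult_ac)
    qed
    moreover have "(\<lambda>N. (real t / real m * (real (m + 1) / real m) ^ (m - t)) ^ N * C) \<longlonglongrightarrow> 0 * C"
      using that ratio_below_less[of t m] by (intro tendsto_mult tendsto_const LIMSEQ_power_zero) auto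
    ultimately show ?thesis by simp
  qed
  then have "(\<lambda>N. \<Sum>t=1..<m. real (t + m) * \<bar>a N t\<bar> / (c * \<bar>y m N\<bar>) ^ (m - t) / \<bar>a N m\<bar>) \<longlonglongrightarrow> (\<Sum>t=1..<m. 0)"
    by (rule tendsto_sum)
  then show ?thesis
    by (simp add: below_def sum_divide_distrib)
qed

end

section \<open>Location of the zeros\<close>

context coefficient_family
begin

text \<open>Factoring out |x|^m leaves the powers |x|^(s + 2) \<le> r^(s + 2). The hypothesis on
  \<open>w\<close> admits both weights used later, \<open>1\<close> and
  \<open>t - m\<close>.\<close>

lemma upper_tail:
  assumes "m > 0" "\<bar>x\<bar> \<le> r" and w: "\<And>t. \<bar>w t\<bar> \<le> real t + real m"
  shows "summable (\<lambda>s. w (s + m + 2) * a N (s + m + 2) * x ^ (s + m + 2))"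
    and "\<bar>\<Sum>s. w (s + m + 2) * a N (s + m + 2) * x ^ (s + m + 2)\<bar> \<le> above m r N * \<bar>a N m * x ^ m\<bar>"
proof -
  let ?f = "\<lambda>s. w (s + m + 2) * a N (s + m + 2) * x ^ (s + m + 2)"
  let ?g = "\<lambda>s. \<bar>x\<bar> ^ m * (real (s + m + 2 + m) * \<bar>a N (s + m + 2)\<bar> * r ^ (s + 2))"
  have r: "r \<ge> 0" using assms(2) by linarith
  have sg: "summable ?g"
    by (intro summable_mult summable_above r)
  have le: "norm (?f s) \<le> ?g s" for s
  proof -
    have "norm (?f s) = \<bar>x\<bar> ^ m * (\<bar>w (s + m + 2)\<bar> * \<bar>a N (s + m + 2)\<bar> * \<bar>x\<bar> ^ (s + 2))"
      by (simp add: abs_mult power_abs power_add power2_eq_square)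
    also have "\<dots> \<le> ?g s"
      using w[of "s + m + 2"] assms(2) by (intro mult_left_mono mult_mono power_mono) auto
    finally show ?thesis .
  qed
  show "summable ?f"
    by (rule summable_comparison_test'[OF sg, of 0]) (rule le)
  have "\<bar>suminf ?f\<bar> \<le> suminf ?g"
    using norm_suminf_le[of ?f ?g, OF le sg] by simp
  also have "\<dots> = \<bar>x\<bar> ^ m * (\<Sum>s. real (s + m + 2 + m) * \<bar>a N (s + m + 2)\<bar> * r ^ (s + 2))"
    by (intro suminf_mult summable_above r)
  also have "\<dots> = above m r N * \<bar>a N m * x ^ m\<bar>"
    using a_nz[OF assms(1), of N] by (simp add: above_def abs_mult power_abs)
  finally show "\<bar>suminf ?f\<bar> \<le> above m r N * \<bar>a N m * x ^ m\<bar>" .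
qed

lemma lower_tail:
  assumes "m > 0" "0 < r" "r \<le> \<bar>x\<bar>" and w: "\<And>t. \<bar>w t\<bar> \<le> real t + real m"
  shows "\<bar>\<Sum>t=1..<m. w t * a N t * x ^ t\<bar> \<le> below m r N * \<bar>a N m * x ^ m\<bar>"
proof -
  have "\<bar>\<Sum>t=1..<m. w t * a N t * x ^ t\<bar> \<le> (\<Sum>t=1..<m. \<bar>w t * a N t * x ^ t\<bar>)"
    by (rule sum_abs)
  also have "\<dots> \<le> (\<Sum>t=1..<m. real (t + m) * \<bar>a N t\<bar> / r ^ (m - t) * \<bar>x\<bar> ^ m)"
  proof (rule sum_mono)
    fix t assume t: "t \<in> {1..<m}"
    have "r ^ (m - t) * \<bar>x\<bar> ^ t \<le> \<bar>x\<bar> ^ (m - t) * \<bar>x\<bar> ^ t"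
      using assms by (intro mult_right_mono power_mono) auto
    also have "\<dots> = \<bar>x\<bar> ^ m" using t by (simp flip: power_add)
    finally have "\<bar>x\<bar> ^ t \<le> \<bar>x\<bar> ^ m / r ^ (m - t)"
      using assms by (simp add: field_simps)
    then have "\<bar>w t\<bar> * \<bar>a N t\<bar> * \<bar>x\<bar> ^ t \<le> real (t + m) * \<bar>a N t\<bar> * (\<bar>x\<bar> ^ m / r ^ (m - t))"
      using w[of t] by (intro mult_mono) auto
    then show "\<bar>w t * a N t * x ^ t\<bar> \<le> real (t + m) * \<bar>a N t\<bar> / r ^ (m - t) * \<bar>x\<bar> ^ m"
      by (simp add: abs_mult power_abs)
  qed
  also have "\<dots> = (\<Sum>t=1..<m. real (t + m) * \<bar>a N t\<bar> / r ^ (m - t)) * \<bar>x\<bar> ^ m"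
    by (rule sum_distrib_right[symmetric])
  also have "\<dots> = below m r N * \<bar>a N m * x ^ m\<bar>"
    using a_nz[OF assms(1), of N] by (simp add: below_def abs_mult power_abs)
  finally show ?thesis .
qed

lemma split_series:
  assumes "N > 0" "m > 0" "summable (\<lambda>s. w (s + m + 2) * a N (s + m + 2) * x ^ (s + m + 2))"
    and "(\<lambda>t. w t * a N t * x ^ t) sums E"
  shows "E = (\<Sum>t=1..<m. w t * a N t * x ^ t) + w m * (a N m * x ^ m)
    + w (Suc m) * (a N (Suc m) * x ^ Suc m) + (\<Sum>s. w (s + m + 2) * a N (s + m + 2) * x ^ (s + m + 2))"
proof -
  let ?f = "\<lambda>t. w t * a N t * x ^ t"
  have "E = (\<Sum>s. ?f (s + (m + 2))) + (\<Sum>t<m + 2. ?f t)"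
    using suminf_split_initial_segment[of ?f "m + 2"] assms(4) by (simp add: sums_iff)
  also have "(\<Sum>t<m + 2. ?f t) = (\<Sum>t<m. ?f t) + ?f m + ?f (Suc m)" by simp
  also have "{..<m} = insert 0 {1..<m}" using assms(2) by auto
  \<comment> \<open>The constant term vanishes because \<open>0 ^ N = 0\<close> for
    \<open>N > 0\<close>, whatever the value \<open>P 0\<close>.\<close>
  also have "(\<Sum>t\<in>insert 0 {1..<m}. ?f t) = (\<Sum>t=1..<m. ?f t)"
    using assms(1) by (simp add: a_0)
  finally show ?thesis by (simp add: algebra_simps)
qed

text \<open>Divided by the unweighted term of index \<open>m\<close>, the term of index
  \<open>Suc m\<close> becomes \<open>- (x / y m N)\<close> by the choice of \<open>y\<close>, up to
  its weight. What remains are the two tails, each taken at the end of the annulus where its bound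
  is largest.\<close>

lemma two_term_approx:
  assumes "N > 0" "m > 0" and w: "\<And>t. \<bar>w t\<bar> \<le> real t + real m"
    and "(\<lambda>t. w t * a N t * x ^ t) sums E"
    and x: "\<bar>y m N\<bar> / 4 \<le> \<bar>x\<bar>" "\<bar>x\<bar> \<le> 4 * \<bar>y m N\<bar>"
  shows "\<bar>E / (a N m * x ^ m) - w m + w (Suc m) * (x / y m N)\<bar> \<le>
    above m (4 * \<bar>y m N\<bar>) N + below m (\<bar>y m N\<bar> / 4) N"
proof -
  have y: "\<bar>y m N\<bar> > 0" using y_nz assms by simp
  have x0: "x \<noteq> 0" using x y by auto
  note u = upper_tail[OF assms(2) x(2) w]
  have l: "\<bar>\<Sum>t=1..<m. w t * a N t * x ^ t\<bar> \<le> below m (\<bar>y m N\<bar> / 4) N * \<bar>a N m * x ^ m\<bar>"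
    using y by (intro lower_tail assms) auto
  let ?T = "a N m * x ^ m"
  have T: "?T \<noteq> 0" using x0 a_nz[OF assms(2)] by simp
  have "a N (Suc m) * x ^ Suc m = - (x / y m N) * ?T"
    using a_nz[of m N] a_nz[of "Suc m" N] assms by (simp add: y_def)
  then have "E - w m * ?T + w (Suc m) * (x / y m N) * ?T =
      (\<Sum>t=1..<m. w t * a N t * x ^ t) + (\<Sum>s. w (s + m + 2) * a N (s + m + 2) * x ^ (s + m + 2))"
    using split_series[OF assms(1,2) u(1) assms(4)] by simp
  then have "\<bar>E - w m * ?T + w (Suc m) * (x / y m N) * ?T\<bar> \<le>
      (above m (4 * \<bar>y m N\<bar>) N + below m (\<bar>y m N\<bar> / 4) N) * \<bar>?T\<bar>"
    using u(2)[of N] l by (simp only: distrib_right) linarith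
  then have "\<bar>E - w m * ?T + w (Suc m) * (x / y m N) * ?T\<bar> / \<bar>?T\<bar> \<le>
      above m (4 * \<bar>y m N\<bar>) N + below m (\<bar>y m N\<bar> / 4) N"
    using T by (subst pos_divide_le_eq) auto
  also have "\<bar>E - w m * ?T + w (Suc m) * (x / y m N) * ?T\<bar> / \<bar>?T\<bar> =
      \<bar>E / ?T - w m + w (Suc m) * (x / y m N)\<bar>"
    using T unfolding abs_divide[symmetric] by (simp add: add_divide_distrib diff_divide_distrib)
  finally show ?thesis .
qed

section \<open>Ranges without zeros, and the zero in each annulus\<close>

lemma a_sums: "(\<lambda>t. 1 * a N t * x ^ t) sums (exp x * poly (q N) x)"
  using q_sums by (simp add: a_def)

lemma a_Suc: "a (Suc N) t = real t * a N t"
  by (simp add: a_def)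

text \<open>Past 4 |\<open>y m N\<close>| the term of index \<open>m\<close> is at most a quarter of
  the next one. The terms below it add at most a third of it, and
  \<open>(1 + 1 / 3) / 4 = 1 / 3\<close>.\<close>

lemma lower_part_le:
  assumes "m > 0" "4 * \<bar>y m N\<bar> \<le> \<bar>x\<bar>" "below m (4 * \<bar>y m N\<bar>) N \<le> 1 / 3"
  shows "\<bar>\<Sum>t=1..<Suc m. a N t * x ^ t\<bar> \<le> 1 / 3 * \<bar>a N (Suc m) * x ^ Suc m\<bar>"
proof -
  have "\<bar>\<Sum>t=1..<m. 1 * a N t * x ^ t\<bar> \<le> below m (4 * \<bar>y m N\<bar>) N * \<bar>a N m * x ^ m\<bar>"
    using assms y_nz[of m N] by (intro lower_tail) auto
  also have "\<dots> \<le> 1 / 3 * \<bar>a N m * x ^ m\<bar>"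
    using assms by (intro mult_right_mono) auto
  finally have "\<bar>\<Sum>t=1..<m. a N t * x ^ t\<bar> \<le> 1 / 3 * \<bar>a N m * x ^ m\<bar>" by simp
  moreover have "(\<Sum>t=1..<Suc m. a N t * x ^ t) = (\<Sum>t=1..<m. a N t * x ^ t) + a N m * x ^ m"
    using assms by simp
  moreover have "4 * \<bar>a N m * x ^ m\<bar> \<le> \<bar>a N (Suc m) * x ^ Suc m\<bar>"
  proof -
    have "4 * \<bar>a N m * x ^ m\<bar> = \<bar>a N (Suc m)\<bar> * (4 * \<bar>y m N\<bar>) * \<bar>x\<bar> ^ m"
      using abs_a_times[OF assms(1), of N] by (simp add: abs_mult power_abs)
    also have "\<dots> \<le> \<bar>a N (Suc m)\<bar> * \<bar>x\<bar> * \<bar>x\<bar> ^ m"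
      using assms by (intro mult_right_mono mult_left_mono) auto
    finally show ?thesis by (simp add: abs_mult power_abs)
  qed
  ultimately show ?thesis by linarith
qed

text \<open>The term of index \<open>m\<close> outweighs all others: relative to it, the lower terms
  amount to at most 1/3 by \<open>lower_part_le\<close> at \<open>m - 1\<close> (there are none if
  \<open>m = 1\<close>), index \<open>Suc m\<close> to 1/4 and the tail to 1/4, in total
  5/6.\<close>

lemma gap_nonzero:
  assumes "N > 0" "m > 0" "x \<noteq> 0" "\<bar>x\<bar> \<le> \<bar>y m N\<bar> / 4" "above m (\<bar>y m N\<bar> / 4) N \<le> 1 / 4"
    and low: "m = 1 \<or> 4 * \<bar>y (m - 1) N\<bar> \<le> \<bar>x\<bar> \<and> below (m - 1) (4 * \<bar>y (m - 1) N\<bar>) N \<le> 1 / 3"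
  shows "poly (q N) x \<noteq> 0"
proof
  assume "poly (q N) x = 0"
  then have s: "(\<lambda>t. 1 * a N t * x ^ t) sums 0" using a_sums[of N x] by simp
  let ?T = "a N m * x ^ m"
  have T: "\<bar>?T\<bar> > 0" using assms a_nz by simp
  have w: "\<bar>1\<bar> \<le> real t + real m" for t using assms(2) by simp
  note u = upper_tail[OF assms(2,4), of "\<lambda>t. 1" N, OF w]
  have "above m (\<bar>y m N\<bar> / 4) N * \<bar>?T\<bar> \<le> 1 / 4 * \<bar>?T\<bar>"
    using assms(5) by (intro mult_right_mono) auto
  with u(2) have "\<bar>\<Sum>s. a N (s + m + 2) * x ^ (s + m + 2)\<bar> \<le> 1 / 4 * \<bar>?T\<bar>"
    by (simp only: mult_1)
  moreover have "\<bar>\<Sum>t=1..<m. a N t * x ^ t\<bar> \<le> 1 / 3 * \<bar>?T\<bar>"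
  proof (cases "m = 1")
    case False
    then show ?thesis
      using lower_part_le[of "m - 1" N x] low assms(2) by simp
  qed simp
  moreover have "4 * \<bar>a N (Suc m) * x ^ Suc m\<bar> \<le> \<bar>?T\<bar>"
  proof -
    have "4 * \<bar>a N (Suc m) * x ^ Suc m\<bar> = \<bar>a N (Suc m)\<bar> * (4 * \<bar>x\<bar>) * \<bar>x\<bar> ^ m"
      by (simp add: abs_mult power_abs)
    also have "\<dots> \<le> \<bar>a N (Suc m)\<bar> * \<bar>y m N\<bar> * \<bar>x\<bar> ^ m"
      using assms(4) by (intro mult_right_mono mult_left_mono) auto
    finally show ?thesis using abs_a_times[OF assms(2), of N] by (simp add: abs_mult power_abs)
  qed
  moreover have "0 = (\<Sum>t=1..<m. a N t * x ^ t) + ?T + a N (Suc m) * x ^ Suc m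
      + (\<Sum>s. a N (s + m + 2) * x ^ (s + m + 2))"
    using split_series[OF assms(1,2) u(1) s] by (simp only: mult_1)
  ultimately show False using T by linarith
qed

text \<open>The term of index \<open>Suc m\<close> outweighs everything below it, and everything
  above it is positive. Hence the conclusion reaches arbitrarily large \<open>x\<close>.\<close>

lemma poly_pos:
  assumes "N > 0" "m > 0" "4 * \<bar>y m N\<bar> \<le> x" "below m (4 * \<bar>y m N\<bar>) N \<le> 1 / 3"
    and P: "\<And>t. t > m \<Longrightarrow> P t > 0"
  shows "poly (q N) x > 0"
proof -
  have x: "x > 0" using assms y_nz[OF assms(2), of N] by linarith
  let ?T = "a N (Suc m) * x ^ Suc m"
  have T: "?T > 0" using x P by (simp add: a_def)
  have su: "summable (\<lambda>s. 1 * a N (s + Suc m + 2) * x ^ (s + Suc m + 2))"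
    using x by (intro upper_tail(1)[of _ _ x]) auto
  have "\<bar>\<Sum>t=1..<Suc m. a N t * x ^ t\<bar> \<le> 1 / 3 * \<bar>?T\<bar>"
    using assms by (intro lower_part_le) auto
  moreover have "(\<Sum>s. 1 * a N (s + Suc m + 2) * x ^ (s + Suc m + 2)) \<ge> 0"
    using x P by (intro suminf_nonneg su) (auto simp: a_def less_imp_le)
  moreover have "a N (Suc (Suc m)) * x ^ Suc (Suc m) \<ge> 0"
    using x P[of "Suc (Suc m)"] by (simp add: a_def)
  ultimately have "exp x * poly (q N) x > 0"
    using split_series[OF assms(1) _ su a_sums] T by (simp only: mult_1 zero_less_Suc)
  then show ?thesis by (simp add: zero_less_mult_iff)
qed

text \<open>
  Uniqueness is Rolle's theorem for \<open>R x = F x / (a N m * x ^ m)\<close>: with \<open>D\<close> as in the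
  proof, \<open>x * R' x = D x\<close>, in which the term of index \<open>m\<close> drops out, so
  \<open>D x\<close> is close to \<open>- x / y m N\<close>.
\<close>

lemma local_zero:
  assumes N: "N > 0" and m: "m > 0" and e: "0 < e" "e \<le> 1 / 2"
    and small: "above m (4 * \<bar>y m N\<bar>) N + below m (\<bar>y m N\<bar> / 4) N < e / 2"
  shows "q N \<noteq> 0 \<and> (\<exists>z. \<bar>z / y m N - 1\<bar> < e \<and> \<bar>y m N\<bar> / 4 \<le> \<bar>z\<bar> \<and> \<bar>z\<bar> \<le> 4 * \<bar>y m N\<bar> \<and> poly (q N) z = 0 \<and> order z (q N) = 1 \<and>
    (\<forall>x. \<bar>y m N\<bar> / 4 \<le> \<bar>x\<bar> \<and> \<bar>x\<bar> \<le> 4 * \<bar>y m N\<bar> \<and> poly (q N) x = 0 \<longrightarrow> x = z))"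
proof -
  let ?y = "y m N"
  have y: "?y \<noteq> 0" using y_nz m .
  define I where "I = {x. \<bar>?y\<bar> / 4 \<le> \<bar>x\<bar> \<and> \<bar>x\<bar> \<le> 4 * \<bar>?y\<bar>}"
  have I0: "x \<noteq> 0" if "x \<in> I" for x using that y by (auto simp: I_def)
  have near: "x \<in> I" if "1 / 2 \<le> x / ?y" "x / ?y \<le> 3 / 2" for x
  proof -
    have "\<bar>x\<bar> = \<bar>x / ?y\<bar> * \<bar>?y\<bar>" using y by simp
    also have "\<bar>x / ?y\<bar> = x / ?y" using that by linarith
    finally have "\<bar>x\<bar> = x / ?y * \<bar>?y\<bar>" .
    then show ?thesis using mult_right_mono[OF that(1), of "\<bar>?y\<bar>"] mult_right_mono[OF that(2), of "\<bar>?y\<bar>"]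
      by (auto simp: I_def)
  qed
  define R where "R = (\<lambda>x. exp x * poly (q N) x / (a N m * x ^ m))"
  define D where "D = (\<lambda>x. exp x * (poly (q (Suc N)) x - real m * poly (q N) x) / (a N m * x ^ m))"
  have R: "\<bar>R x - 1 + x / ?y\<bar> < e / 2" if "x \<in> I" for x
    using two_term_approx[OF N m _ a_sums, of x] that m small by (simp add: R_def I_def)
  have D: "\<bar>D x + x / ?y\<bar> < e / 2" if "x \<in> I" for x
  proof -
    have "(\<lambda>t. 1 * a (Suc N) t * x ^ t - real m * (1 * a N t * x ^ t)) sums
        (exp x * poly (q (Suc N)) x - real m * (exp x * poly (q N) x))"
      by (intro sums_diff sums_mult a_sums)
    \<comment> \<open>For \<open>F x = exp x * poly (q N) x\<close> this is the series of x F' - m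
      F; its weight is 0 at index \<open>m\<close> and 1 at index \<open>Suc m\<close>.\<close>
    then have S: "(\<lambda>t. (real t - real m) * a N t * x ^ t) sums
        (exp x * (poly (q (Suc N)) x - real m * poly (q N) x))"
      by (simp add: a_Suc algebra_simps)
    have w: "\<bar>real t - real m\<bar> \<le> real t + real m" for t by simp
    show ?thesis
      using two_term_approx[OF N m w S] that small by (simp add: D_def I_def)
  qed
  have zero_near: "\<bar>x / ?y - 1\<bar> < e / 2" if "x \<in> I" "poly (q N) x = 0" for x
    using R[OF that(1)] that(2) by (simp add: R_def abs_minus_commute)
  have D_nz: "D x \<noteq> 0" if "x \<in> I" "x / ?y \<ge> 1 / 2" for x
  proof
    assume "D x = 0"
    then have "\<bar>x / ?y\<bar> < e / 2" using D[OF that(1)] by (simp only: add_0_left)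
    then show False using that(2) e by linarith
  qed
  have unique: False if z: "x < z" "x \<in> I" "z \<in> I" "poly (q N) x = 0" "poly (q N) z = 0" for x z
  proof -
    \<comment> \<open>Both zeros have quotient by \<open>y m N\<close> close to 1, so the interval
      between them stays on one side of 0, where \<open>R\<close> is differentiable.\<close>
    have b: "1 / 2 \<le> u / ?y \<and> u / ?y \<le> 3 / 2" if "x \<le> u" "u \<le> z" for u
    proof -
      have "min (x / ?y) (z / ?y) \<le> u / ?y \<and> u / ?y \<le> max (x / ?y) (z / ?y)"
        using that y by (cases "?y > 0") (auto simp: min_def max_def divide_le_cancel)
      then show ?thesis
        using zero_near[OF z(2,4)] zero_near[OF z(3,5)] e unfolding min_def max_def
        by (cases "x / ?y \<le> z / ?y") (simp_all only: if_True if_False, linarith+)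
    qed
    have nz: "u \<noteq> 0" if "x \<le> u" "u \<le> z" for u using b[OF that] by auto
    define k where "k = m - 1"
    have um: "u ^ m = u * u ^ k" for u :: real using m by (simp add: k_def power_eq_if)
    have der: "(R has_real_derivative D u / u) (at u)" if "u \<noteq> 0" for u
    proof -
      have "(R has_real_derivative
        ((exp u * poly (q N) u + exp u * poly (pderiv (q N)) u) * (a N m * u ^ m)
          - exp u * poly (q N) u * (a N m * (real m * u ^ k))) / (a N m * u ^ m * (a N m * u ^ m))) (at u)"
        unfolding R_def using that a_nz[OF m, of N]
        by (auto intro!: derivative_eq_intros simp: k_def algebra_simps)
      also have "((exp u * poly (q N) u + exp u * poly (pderiv (q N)) u) * (a N m * u ^ m)
          - exp u * poly (q N) u * (a N m * (real m * u ^ k))) / (a N m * u ^ m * (a N m * u ^ m)) = D u / u"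
        unfolding D_def q_Suc using that a_nz[OF m, of N]
        by (simp add: divide_simps um) (simp add: algebra_simps)
      finally show ?thesis .
    qed
    have "\<exists>u. x < u \<and> u < z \<and> (*) (D u / u) = (\<lambda>v. 0)"
    proof (rule Rolle_deriv[OF z(1)])
      show "R x = R z" by (simp add: R_def z)
      show "continuous_on {x..z} R"
        using nz by (intro continuous_at_imp_continuous_on ballI DERIV_isCont[OF der]) auto
      show "(R has_derivative (*) (D u / u)) (at u)" if "x < u" "u < z" for u
        using der[OF nz[of u]] that by (simp add: has_field_derivative_def)
    qed
    then obtain u where u: "x < u" "u < z" "D u / u = 0" by (metis mult.right_neutral)
    then show False using D_nz[OF near, of u] b[of u] nz[of u] by auto
  qed
  \<comment> \<open>Scaling by \<open>y m N\<close> avoids a case distinction on its sign. At the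
    two end points the main part \<open>1 - s\<close> equals \<open>e / 2\<close> and
    \<open>- e / 2\<close>, exactly the error bound, which fixes the signs of
    \<open>R\<close>.\<close>
  have "\<exists>s\<ge>1 - e / 2. s \<le> 1 + e / 2 \<and> R (s * ?y) = 0"
  proof (rule IVT2')
    have I: "(1 - e / 2) * ?y \<in> I" "(1 + e / 2) * ?y \<in> I"
      using e y by (auto intro!: near)
    have "\<bar>R ((1 + e / 2) * ?y) - 1 + (1 + e / 2)\<bar> < e / 2" "\<bar>R ((1 - e / 2) * ?y) - 1 + (1 - e / 2)\<bar> < e / 2"
      using R[OF I(2)] R[OF I(1)] y by simp_all
    then show "R ((1 + e / 2) * ?y) \<le> 0" "0 \<le> R ((1 - e / 2) * ?y)"
      by (simp_all only: abs_less_iff) linarith+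
    show "1 - e / 2 \<le> 1 + e / 2" using e by simp
    show "continuous_on {1 - e / 2..1 + e / 2} (\<lambda>s. R (s * ?y))"
      unfolding R_def by (intro continuous_intros) (use e y a_nz[OF m] in auto)
  qed
  then obtain s where s: "1 - e / 2 \<le> s" "s \<le> 1 + e / 2" "R (s * ?y) = 0" by auto
  define z where "z = s * ?y"
  have sz: "z / ?y = s" using y by (simp add: z_def)
  have zI: "z \<in> I" using s e by (intro near) (auto simp: sz)
  have root: "poly (q N) z = 0" using s(3) I0[OF zI] a_nz[OF m, of N] by (auto simp: R_def z_def)
  \<comment> \<open>At a zero of \<open>q N\<close>, \<open>D z\<close> is a multiple of
    \<open>poly (q (Suc N)) z\<close>, hence by \<open>q_Suc\<close> of the derivative of
    \<open>q N\<close> at \<open>z\<close>. So \<open>D_nz\<close> makes the zero simple.\<close>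
  have "poly (q (Suc N)) z \<noteq> 0"
    using D_nz[OF zI] s e I0[OF zI] sz root by (auto simp: D_def)
  then have d: "poly (pderiv (q N)) z \<noteq> 0" using root by (auto simp: q_Suc)
  then have q: "q N \<noteq> 0" by auto
  then have order: "order z (q N) = 1" using order_pderiv[OF _ root] order_0I[OF d] by simp
  have uniq: "x = z" if "x \<in> I" "poly (q N) x = 0" for x
    using unique[of x z] unique[of z x] that zI root by (cases x z rule: linorder_cases) auto
  have "\<bar>z / ?y - 1\<bar> < e" unfolding sz using s e by linarith
  then show ?thesis
    using zI root q order uniq unfolding I_def mem_Collect_eq by blast
qed

end

section \<open>Enumeration of the zeros\<close>

text \<open>Treats finite and infinite \<open>S\<close> together, for later use with
  \<open>H\<close> and \<open>G\<close>. Since \<open>enumerate S\<close> increases, the elements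
  below its value at \<open>k\<close> are its values at \<open>0, ..., k - 1\<close>.\<close>

lemma enumerate_rank:
  fixes S :: "nat set"
  assumes "infinite S \<or> k < card S"
  shows "enumerate S k \<in> S" "card {i \<in> S. i < enumerate S k} = k"
proof -
  show "enumerate S k \<in> S"
    using assms enumerate_in_set finite_enumerate_in_set by blast
  have mono: "enumerate S i < enumerate S j" if "i < j" "infinite S \<or> j < card S" for i j
    using that enumerate_mono finite_enumerate_mono by blast
  have "{i \<in> S. i < enumerate S k} = enumerate S ` {..<k}"
  proof (intro equalityI subsetI)
    fix i assume "i \<in> {i \<in> S. i < enumerate S k}"
    then have i: "i \<in> S" "i < enumerate S k" by auto
    obtain j where j: "enumerate S j = i" "infinite S \<or> j < card S"
      using i(1) enumerate_Ex finite_enumerate_Ex by metis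
    have "j < k"
    proof (rule ccontr)
      assume "\<not> j < k"
      then consider "j = k" | "k < j" by linarith
      then show False using j i(2) mono[of k j] by cases auto
    qed
    then show "i \<in> enumerate S ` {..<k}" using j by auto
  next
    fix i assume "i \<in> enumerate S ` {..<k}"
    then obtain j where j: "j < k" "i = enumerate S j" by auto
    then have "infinite S \<or> j < card S" using assms by auto
    then have "i \<in> S" using j enumerate_in_set finite_enumerate_in_set by blast
    then show "i \<in> {i \<in> S. i < enumerate S k}" using j mono[of j k] assms by auto
  qed
  moreover have "inj_on (enumerate S) {..<k}"
  proof (rule linorder_inj_onI)
    fix i j assume "i < j" "i \<in> {..<k}" "j \<in> {..<k}"
    then show "enumerate S i \<noteq> enumerate S j" using mono[of i j] assms by auto
  qed auto
  ultimately show "card {i \<in> S. i < enumerate S k} = k"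
    by (simp add: card_image)
qed

text \<open>
  Both lists of zeros in the theorem are sorted by absolute value, so this applies with
  \<open>f = abs\<close> to either of them.
\<close>

lemma nth_eq_of_rank:
  fixes f :: "'a \<Rightarrow> 'b :: linorder"
  assumes "sorted_wrt (\<lambda>u v. f u \<le> f v) xs" "x \<in> set xs" "inj_on f (set xs)"
  shows "length (filter (\<lambda>u. f u < f x) xs) < length xs"
    and "xs ! length (filter (\<lambda>u. f u < f x) xs) = x"
proof -
  show "length (filter (\<lambda>u. f u < f x) xs) < length xs"
    using assms(2) by (intro length_filter_less) auto
  show "xs ! length (filter (\<lambda>u. f u < f x) xs) = x"
    using assms
  proof (induction xs)
    case (Cons z zs)
    show ?case
    proof (cases "f z < f x")
      case True
      then show ?thesis using Cons by auto
    next
      case False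
      then have "f z = f x" using Cons.prems by force
      then have "z = x" using Cons.prems by (auto dest: inj_onD)
      moreover have "filter (\<lambda>u. f u < f x) zs = []"
        using Cons.prems \<open>z = x\<close> by (auto simp: filter_empty_conv)
      ultimately show ?thesis by simp
    qed
  qed simp
qed

section \<open>Zeros of separated moduli and their positions in the sorted lists\<close>

context coefficient_family
begin

text \<open>Gathers the smallness conditions of \<open>local_zero\<close>,
  \<open>gap_nonzero\<close> and \<open>poly_pos\<close> for all \<open>m\<close> up to
  \<open>L\<close>. The factor 16 makes the annuli from |\<open>y m N\<close>| / 4 to 4
  |\<open>y m N\<close>| disjoint.\<close>

definition separated :: "real \<Rightarrow> nat \<Rightarrow> nat \<Rightarrow> bool" where
  "separated e L N \<longleftrightarrow> N > 0 \<and> (\<forall>m\<in>{1..L}.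
    above m (4 * \<bar>y m N\<bar>) N + below m (\<bar>y m N\<bar> / 4) N < e / 2 \<and>
    above m (\<bar>y m N\<bar> / 4) N \<le> 1 / 4 \<and> below m (4 * \<bar>y m N\<bar>) N \<le> 1 / 3 \<and>
    16 * \<bar>y m N\<bar> < \<bar>y (Suc m) N\<bar>)"

lemma y_ratio_tendsto:
  assumes "m > 0"
  shows "(\<lambda>N. y m N / y (Suc m) N) \<longlonglongrightarrow> 0"
proof -
  define u where "u = real m / real (m + 1) * (real (m + 2) / real (m + 1))"
  define c where "c = (real (m + 1) * P m / P (m + 1)) / (real (m + 2) * P (m + 1) / P (m + 2))"
  have "y m N / y (Suc m) N = u ^ N * c" for N
    using assms by (simp add: y_eq u_def c_def power_mult_distrib power_divide mult_ac)
  moreover have "real m * real (m + 2) < real (m + 1) * real (m + 1)"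
    by (simp add: algebra_simps)
  then have "u < 1" unfolding u_def times_divide_times_eq by (subst divide_less_eq_1_pos) auto
  then have "(\<lambda>N. u ^ N * c) \<longlonglongrightarrow> 0 * c"
    by (intro tendsto_mult tendsto_const LIMSEQ_power_zero) (simp add: u_def)
  ultimately show ?thesis by simp
qed

lemma eventually_separated:
  assumes "e > 0"
  shows "eventually (separated e L) sequentially"
proof -
  have "\<forall>\<^sub>F N in sequentially. above m (4 * \<bar>y m N\<bar>) N + below m (\<bar>y m N\<bar> / 4) N < e / 2 \<and>
    above m (\<bar>y m N\<bar> / 4) N \<le> 1 / 4 \<and> below m (4 * \<bar>y m N\<bar>) N \<le> 1 / 3 \<and>
    16 * \<bar>y m N\<bar> < \<bar>y (Suc m) N\<bar>" if "m \<in> {1..L}" for m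
  proof -
    have m: "m > 0" using that by simp
    have "(\<lambda>N. above m (4 * \<bar>y m N\<bar>) N + below m (1 / 4 * \<bar>y m N\<bar>) N) \<longlonglongrightarrow> 0 + 0"
      by (intro tendsto_add above_tendsto below_tendsto m) auto
    then have "\<forall>\<^sub>F N in sequentially. above m (4 * \<bar>y m N\<bar>) N + below m (1 / 4 * \<bar>y m N\<bar>) N < e / 2"
      using assms by (intro order_tendstoD(2)) auto
    moreover have "\<forall>\<^sub>F N in sequentially. above m (1 / 4 * \<bar>y m N\<bar>) N < 1 / 4"
      using m by (intro order_tendstoD(2)[OF above_tendsto]) auto
    moreover have "\<forall>\<^sub>F N in sequentially. below m (4 * \<bar>y m N\<bar>) N < 1 / 3"
      using m by (intro order_tendstoD(2)[OF below_tendsto]) auto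
    moreover have "\<forall>\<^sub>F N in sequentially. \<bar>y m N / y (Suc m) N\<bar> < 1 / 16"
      using tendsto_rabs[OF y_ratio_tendsto[OF m]] by (intro order_tendstoD(2)) auto
    ultimately show ?thesis
    proof eventually_elim
      case (elim N)
      then show ?case using y_nz[of "Suc m" N] by (simp add: abs_divide field_simps)
    qed
  qed
  then have "\<forall>\<^sub>F N in sequentially. \<forall>m\<in>{1..L}. above m (4 * \<bar>y m N\<bar>) N + below m (\<bar>y m N\<bar> / 4) N < e / 2 \<and>
    above m (\<bar>y m N\<bar> / 4) N \<le> 1 / 4 \<and> below m (4 * \<bar>y m N\<bar>) N \<le> 1 / 3 \<and>
    16 * \<bar>y m N\<bar> < \<bar>y (Suc m) N\<bar>"
    by (intro eventually_ball_finite ballI) auto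
  then show ?thesis
    unfolding separated_def by (intro eventually_conj eventually_gt_at_top)
qed

text \<open>Take the least \<open>m\<close> with |x| \<le> 4 |\<open>y m N\<close>|. By minimality
  |x| is at least 4 |\<open>y (m - 1) N\<close>| if \<open>m > 1\<close>, so below
  |\<open>y m N\<close>| / 4 it would fall into the gap covered by
  \<open>gap_nonzero\<close>.\<close>

lemma zero_in_annulus:
  assumes "separated e L N" "x \<noteq> 0" "\<bar>x\<bar> \<le> 4 * \<bar>y L N\<bar>" "poly (q N) x = 0" "L > 0"
  shows "\<exists>m\<in>{1..L}. \<bar>y m N\<bar> / 4 \<le> \<bar>x\<bar> \<and> \<bar>x\<bar> \<le> 4 * \<bar>y m N\<bar>"
proof -
  define m where "m = (LEAST m. m > 0 \<and> \<bar>x\<bar> \<le> 4 * \<bar>y m N\<bar>)"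
  have m: "m > 0" "\<bar>x\<bar> \<le> 4 * \<bar>y m N\<bar>" "m \<le> L"
    using LeastI[of "\<lambda>m. m > 0 \<and> \<bar>x\<bar> \<le> 4 * \<bar>y m N\<bar>" L] Least_le[of "\<lambda>m. m > 0 \<and> \<bar>x\<bar> \<le> 4 * \<bar>y m N\<bar>" L] assms
    by (auto simp: m_def)
  have low: "4 * \<bar>y (m - 1) N\<bar> \<le> \<bar>x\<bar>" if "m \<noteq> 1"
  proof (rule ccontr)
    assume "\<not> 4 * \<bar>y (m - 1) N\<bar> \<le> \<bar>x\<bar>"
    then have "m - 1 > 0 \<and> \<bar>x\<bar> \<le> 4 * \<bar>y (m - 1) N\<bar>" using that m by auto
    then have "m \<le> m - 1" unfolding m_def by (rule Least_le)
    then show False using m by simp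
  qed
  have "\<bar>y m N\<bar> / 4 \<le> \<bar>x\<bar>"
  proof (rule ccontr)
    assume "\<not> \<bar>y m N\<bar> / 4 \<le> \<bar>x\<bar>"
    moreover have "m - 1 \<in> {1..L}" if "m \<noteq> 1" using that m by auto
    ultimately have "poly (q N) x \<noteq> 0"
      using assms m low unfolding separated_def
      by (intro gap_nonzero[of N m]) auto
    then show False using assms by simp
  qed
  then show ?thesis using m by auto
qed

text \<open>\<open>local_zero\<close> supplies one zero per annulus, the factor 16 orders these by
  modulus, and \<open>zero_in_annulus\<close> leaves room for no others.\<close>

lemma separated_zeros:
  assumes sep: "separated e L N" and e: "0 < e" "e \<le> 1 / 2" and L: "L > 0"
  obtains \<xi> :: "nat \<Rightarrow> real" where
    "q N \<noteq> 0"
    "\<And>m. m \<in> {1..L} \<Longrightarrow> \<bar>\<xi> m / y m N - 1\<bar> < e"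
    "\<And>m. m \<in> {1..L} \<Longrightarrow> poly (q N) (\<xi> m) = 0"
    "\<And>m. m \<in> {1..L} \<Longrightarrow> order (\<xi> m) (q N) = 1"
    "\<And>i j. i \<in> {1..L} \<Longrightarrow> j \<in> {1..L} \<Longrightarrow> i < j \<Longrightarrow> \<bar>\<xi> i\<bar> < \<bar>\<xi> j\<bar>"
    "\<bar>\<xi> L\<bar> \<le> 4 * \<bar>y L N\<bar>"
    "\<And>x. x \<noteq> 0 \<Longrightarrow> \<bar>x\<bar> \<le> 4 * \<bar>y L N\<bar> \<Longrightarrow> poly (q N) x = 0 \<Longrightarrow> x \<in> \<xi> ` {1..L}"
proof -
  let ?A = "\<lambda>m x. \<bar>y m N\<bar> / 4 \<le> \<bar>x\<bar> \<and> \<bar>x\<bar> \<le> 4 * \<bar>y m N\<bar>"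
  have ex: "q N \<noteq> 0 \<and> (\<exists>z. \<bar>z / y m N - 1\<bar> < e \<and> \<bar>y m N\<bar> / 4 \<le> \<bar>z\<bar> \<and> \<bar>z\<bar> \<le> 4 * \<bar>y m N\<bar> \<and> poly (q N) z = 0 \<and> order z (q N) = 1 \<and>
    (\<forall>x. \<bar>y m N\<bar> / 4 \<le> \<bar>x\<bar> \<and> \<bar>x\<bar> \<le> 4 * \<bar>y m N\<bar> \<and> poly (q N) x = 0 \<longrightarrow> x = z))" if "m \<in> {1..L}" for m
    using sep that unfolding separated_def by (intro local_zero e) auto
  then obtain \<xi> where \<xi>: "\<And>m. m \<in> {1..L} \<Longrightarrow> \<bar>\<xi> m / y m N - 1\<bar> < e \<and> ?A m (\<xi> m) \<and>
      poly (q N) (\<xi> m) = 0 \<and> order (\<xi> m) (q N) = 1 \<and> (\<forall>x. ?A m x \<and> poly (q N) x = 0 \<longrightarrow> x = \<xi> m)"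
    by (atomize_elim, intro choice) (metis (no_types, lifting))
  have ysep: "16 * \<bar>y i N\<bar> < \<bar>y j N\<bar>" if "i \<in> {1..L}" "j \<in> {1..L}" "i < j" for i j
    using that(3,1,2)
  proof (induction rule: less_Suc_induct)
    case (1 i)
    then show ?case using sep by (auto simp: separated_def)
  next
    case (2 i j k)
    then have "j \<in> {1..L}" by auto
    with 2 show ?case by force
  qed
  show thesis
  proof
    show "q N \<noteq> 0" using ex[of L] L by auto
    show "\<bar>\<xi> i\<bar> < \<bar>\<xi> j\<bar>" if "i \<in> {1..L}" "j \<in> {1..L}" "i < j" for i j
      using ysep[OF that] \<xi>[OF that(1)] \<xi>[OF that(2)] by linarith
    show "x \<in> \<xi> ` {1..L}" if "x \<noteq> 0" "\<bar>x\<bar> \<le> 4 * \<bar>y L N\<bar>" "poly (q N) x = 0" for x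
      using zero_in_annulus[OF sep that L] \<xi> that by blast
  qed (use \<xi> L in auto)
qed

text \<open>Multiplying by the square of \<open>P (Suc m)\<close> turns the quotient in
  \<open>y\<close> into a product. The parameter \<open>s\<close>, later \<open>1\<close> or
  \<open>- 1\<close>, treats both signs at once.\<close>

lemma y_sign: "m > 0 \<Longrightarrow> s * y m N > 0 \<longleftrightarrow> s * (P m * P (Suc m)) < 0"
proof -
  assume m: "m > 0"
  define C where "C = real (m + 1) * (real m / real (m + 1)) ^ N"
  have "y m N * (P (Suc m))\<^sup>2 = - (P m * P (Suc m)) * C"
    using P_nz[of "Suc m"] m by (simp add: y_eq C_def power2_eq_square)
  then have "s * y m N * (P (Suc m))\<^sup>2 = - (s * (P m * P (Suc m))) * C"
    by algebra
  moreover have "(P (Suc m))\<^sup>2 > 0" "C > 0"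
    using P_nz[of "Suc m"] m by (auto simp: C_def)
  ultimately show ?thesis
    by (metis mult_less_0_iff neg_0_less_iff_less zero_less_mult_pos2 zero_less_mult_iff)
qed

lemma near_sign:
  assumes "\<bar>z / y m N - 1\<bar> < e" "e \<le> 1 / 2"
  shows "s * z > 0 \<longleftrightarrow> s * y m N > 0"
proof -
  have r: "z / y m N > 0" using assms by linarith
  then have "y m N \<noteq> 0" by auto
  then have "s * z = (s * y m N) * (z / y m N)" by simp
  then show ?thesis using r by (metis zero_less_mult_iff less_asym)
qed

text \<open>For \<open>s = 1\<close> the set \<open>S\<close> becomes \<open>H\<close> and
  \<open>zs\<close> lists the positive zeros; for \<open>s = - 1\<close> they become
  \<open>G\<close> and the negative ones. With \<open>m = enumerate S k\<close>, the zeros of this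
  sign with modulus below that of \<open>\<xi> m\<close> are the \<open>\<xi> i\<close> with
  \<open>i < m\<close> in \<open>S\<close>. These are \<open>k\<close> simple zeros, so
  \<open>\<xi> m\<close> stands at position \<open>k\<close>.\<close>

lemma signed_zeros:
  fixes s :: real
  defines "S \<equiv> {l. l > 0 \<and> s * (P l * P (Suc l)) < 0}"
  assumes k: "infinite S \<or> k < card S" and e: "0 < e" "e \<le> 1 / 2"
  shows "\<forall>\<^sub>F N in sequentially. \<forall>zs. sorted_wrt (\<lambda>u v. \<bar>u\<bar> \<le> \<bar>v\<bar>) zs \<and>
    mset zs = filter_mset (\<lambda>x. s * x > 0) (proots (q N)) \<longrightarrow>
    k < length zs \<and> \<bar>zs ! k / y (enumerate S k) N - 1\<bar> < e \<and> order (zs ! k) (q N) = 1"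
proof -
  define m where "m = enumerate S k"
  have mS: "m \<in> S" and rank: "card {i \<in> S. i < m} = k"
    using enumerate_rank[OF k] by (auto simp: m_def)
  have m: "m > 0" using mS by (simp add: S_def)
  show ?thesis
    using eventually_separated[OF e(1), of m]
  proof (rule eventually_mono, intro allI impI, elim conjE)
    fix N zs
    assume sep: "separated e m N"
      and srt: "sorted_wrt (\<lambda>u v. \<bar>u\<bar> \<le> \<bar>v\<bar>) zs"
      and zs: "mset zs = filter_mset (\<lambda>x. s * x > 0) (proots (q N))"
    obtain \<xi> where q: "q N \<noteq> 0"
      and near: "\<And>m'. m' \<in> {1..m} \<Longrightarrow> \<bar>\<xi> m' / y m' N - 1\<bar> < e"
      and root: "\<And>m'. m' \<in> {1..m} \<Longrightarrow> poly (q N) (\<xi> m') = 0"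
      and simple: "\<And>m'. m' \<in> {1..m} \<Longrightarrow> order (\<xi> m') (q N) = 1"
      and mono: "\<And>i j. i \<in> {1..m} \<Longrightarrow> j \<in> {1..m} \<Longrightarrow> i < j \<Longrightarrow> \<bar>\<xi> i\<bar> < \<bar>\<xi> j\<bar>"
      and top: "\<bar>\<xi> m\<bar> \<le> 4 * \<bar>y m N\<bar>"
      and all: "\<And>x. x \<noteq> 0 \<Longrightarrow> \<bar>x\<bar> \<le> 4 * \<bar>y m N\<bar> \<Longrightarrow> poly (q N) x = 0 \<Longrightarrow> x \<in> \<xi> ` {1..m}"
      by (rule separated_zeros[OF sep e m], rule that)
    have sgn: "s * \<xi> i > 0 \<longleftrightarrow> i \<in> S" if "i \<in> {1..m}" for i
      using near_sign[OF near[OF that] e(2)] y_sign[of i s N] that by (auto simp: S_def)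
    have set_zs: "set zs = {x. s * x > 0 \<and> poly (q N) x = 0}"
      using arg_cong[OF zs, of set_mset] q by auto
    have mem: "\<xi> m \<in> set zs" using sgn[of m] mS m root[of m] by (auto simp: set_zs)
    have inj: "inj_on abs (set zs)"
      by (rule inj_onI) (auto simp: set_zs abs_if zero_less_mult_iff split: if_splits)
    define F where "F = filter_mset (\<lambda>u. \<bar>u\<bar> < \<bar>\<xi> m\<bar>) (mset zs)"
    have mono_iff: "\<bar>\<xi> i\<bar> < \<bar>\<xi> m\<bar> \<longleftrightarrow> i < m" if "i \<in> {1..m}" for i
      using mono[of i m] that m by (cases "i = m") auto
    have "set_mset F = \<xi> ` {i \<in> S. i < m}"
    proof (intro equalityI subsetI)
      fix x assume "x \<in> set_mset F"
      then have x: "\<bar>x\<bar> < \<bar>\<xi> m\<bar>" "s * x > 0" "poly (q N) x = 0" by (auto simp: F_def set_zs)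
      then obtain i where "i \<in> {1..m}" "x = \<xi> i" using all[of x] top by force
      then show "x \<in> \<xi> ` {i \<in> S. i < m}" using sgn mono_iff x by auto
    next
      fix x assume "x \<in> \<xi> ` {i \<in> S. i < m}"
      then obtain i where i: "i \<in> S" "i < m" "x = \<xi> i" by auto
      then have "i \<in> {1..m}" by (auto simp: S_def)
      then show "x \<in> set_mset F" using i sgn mono_iff root by (auto simp: F_def set_zs)
    qed
    moreover have "inj_on \<xi> {i \<in> S. i < m}"
    proof (rule linorder_inj_onI)
      fix i j assume "i < j" "i \<in> {i \<in> S. i < m}" "j \<in> {i \<in> S. i < m}"
      then have "\<bar>\<xi> i\<bar> < \<bar>\<xi> j\<bar>" by (intro mono) (auto simp: S_def)
      then show "\<xi> i \<noteq> \<xi> j" by auto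
    qed auto
    ultimately have "card (set_mset F) = k" by (simp add: card_image rank)
    moreover have "count F x = 1" if "x \<in> set_mset F" for x
    proof -
      have "x \<noteq> 0" "\<bar>x\<bar> \<le> 4 * \<bar>y m N\<bar>" "poly (q N) x = 0" "\<bar>x\<bar> < \<bar>\<xi> m\<bar>" "s * x > 0"
        using that top by (auto simp: F_def set_zs)
      moreover from this obtain i where "i \<in> {1..m}" "x = \<xi> i" using all by blast
      ultimately show ?thesis using simple[of i] q by (simp add: F_def zs)
    qed
    ultimately have "size F = k" by (simp add: size_multiset_overloaded_eq)
    then have "length (filter (\<lambda>u. \<bar>u\<bar> < \<bar>\<xi> m\<bar>) zs) = k"
      by (metis F_def mset_filter size_mset)
    then have "k < length zs" "zs ! k = \<xi> m"
      using nth_eq_of_rank[OF srt mem inj] by auto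
    then show "k < length zs \<and> \<bar>zs ! k / y (enumerate S k) N - 1\<bar> < e \<and> order (zs ! k) (q N) = 1"
      using near[of m] simple[of m] m by (auto simp: m_def)
  qed
qed

text \<open>All sign changes of \<open>P\<close> start at indices up to \<open>M\<close>. Separation
  up to \<open>M\<close> locates the zeros of modulus at most 4 |\<open>y M N\<close>|, and
  \<open>poly_pos\<close> excludes larger positive ones.\<close>

lemma positive_zeros:
  assumes M: "\<And>t. t > M \<Longrightarrow> P t > 0" "M > 0"
  shows "\<forall>\<^sub>F N in sequentially. card {x. x > 0 \<and> poly (q N) x = 0} = card {l. l > 0 \<and> P l * P (Suc l) < 0} \<and>
    (\<forall>x. x > 0 \<and> poly (q N) x = 0 \<longrightarrow> order x (q N) = 1)"
proof -
  define S where "S = {l. l > 0 \<and> P l * P (Suc l) < 0}"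
  have S: "S \<subseteq> {1..M}"
  proof
    fix l assume "l \<in> S"
    then have "\<not> l > M" using M(1)[of l] M(1)[of "Suc l"] by (auto simp: S_def mult_less_0_iff)
    then show "l \<in> {1..M}" using \<open>l \<in> S\<close> by (auto simp: S_def)
  qed
  \<comment> \<open>Only the signs of the \<open>\<xi> m\<close> matter here, and accuracy 1/2
    determines them.\<close>
  have half: "0 < (1 / 2 :: real)" "1 / 2 \<le> (1 / 2 :: real)" by simp_all
  show ?thesis
    using eventually_separated[OF half(1), of M]
  proof (rule eventually_mono)
    fix N
    assume sep: "separated (1 / 2) M N"
    obtain \<xi> where "q N \<noteq> 0" and near: "\<And>m'. m' \<in> {1..M} \<Longrightarrow> \<bar>\<xi> m' / y m' N - 1\<bar> < 1 / 2"
      and root: "\<And>m'. m' \<in> {1..M} \<Longrightarrow> poly (q N) (\<xi> m') = 0"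
      and simple: "\<And>m'. m' \<in> {1..M} \<Longrightarrow> order (\<xi> m') (q N) = 1"
      and mono: "\<And>i j. i \<in> {1..M} \<Longrightarrow> j \<in> {1..M} \<Longrightarrow> i < j \<Longrightarrow> \<bar>\<xi> i\<bar> < \<bar>\<xi> j\<bar>"
      and "\<bar>\<xi> M\<bar> \<le> 4 * \<bar>y M N\<bar>"
      and all: "\<And>x. x \<noteq> 0 \<Longrightarrow> \<bar>x\<bar> \<le> 4 * \<bar>y M N\<bar> \<Longrightarrow> poly (q N) x = 0 \<Longrightarrow> x \<in> \<xi> ` {1..M}"
      by (rule separated_zeros[OF sep half M(2)], rule that)
    have sgn: "\<xi> i > 0 \<longleftrightarrow> i \<in> S" if "i \<in> {1..M}" for i
      using near_sign[OF near[OF that], of 1] y_sign[of i 1 N] that by (auto simp: S_def)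
    have zeros: "{x. x > 0 \<and> poly (q N) x = 0} = \<xi> ` S"
    proof (intro equalityI subsetI)
      fix x assume "x \<in> {x. x > 0 \<and> poly (q N) x = 0}"
      then have x: "x > 0" "poly (q N) x = 0" by auto
      have "\<not> 4 * \<bar>y M N\<bar> \<le> x"
      proof
        assume "4 * \<bar>y M N\<bar> \<le> x"
        then have "poly (q N) x > 0"
          using sep M by (intro poly_pos[of N M]) (auto simp: separated_def)
        then show False using x by simp
      qed
      then have "x \<in> \<xi> ` {1..M}" using x by (intro all) auto
      then show "x \<in> \<xi> ` S" using sgn x by auto
    next
      fix x assume "x \<in> \<xi> ` S"
      then show "x \<in> {x. x > 0 \<and> poly (q N) x = 0}" using S sgn root by auto
    qed
    have "inj_on \<xi> S"
    proof (rule linorder_inj_onI)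
      fix i j assume "i < j" "i \<in> S" "j \<in> S"
      then have "\<bar>\<xi> i\<bar> < \<bar>\<xi> j\<bar>" using S by (intro mono) auto
      then show "\<xi> i \<noteq> \<xi> j" by auto
    qed auto
    then have "card {x. x > 0 \<and> poly (q N) x = 0} = card S"
      by (simp add: zeros card_image)
    moreover have "order x (q N) = 1" if "x > 0" "poly (q N) x = 0" for x
    proof -
      have "x \<in> \<xi> ` S" using zeros that by blast
      then show ?thesis using simple S by auto
    qed
    ultimately show "card {x. x > 0 \<and> poly (q N) x = 0} = card {l. l > 0 \<and> P l * P (Suc l) < 0} \<and>
      (\<forall>x. x > 0 \<and> poly (q N) x = 0 \<longrightarrow> order x (q N) = 1)"
      by (simp add: S_def)
  qed
qed

end

section \<open>Application to combinations of Bell polynomials\<close>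

lemma bell_comb_coefficient_family:
  fixes K :: nat and \<gamma> :: "nat \<Rightarrow> real"
  defines "P \<equiv> \<lambda>x. \<Sum>j\<le>K. \<gamma> j * x ^ (K - j)"
  assumes "\<And>m::nat. m > 0 \<Longrightarrow> P (real m) \<noteq> 0"
  shows "coefficient_family (\<lambda>t. P (real t)) (\<lambda>N. bell_comb K \<gamma> (N + K))"
proof
  \<comment> \<open>As \<open>j \<le> K\<close>, the index \<open>N + K - j\<close> equals
    \<open>N + (K - j)\<close>, so every summand contains a genuine Bell polynomial.\<close>
  have comb: "bell_comb K \<gamma> (N + K) = (\<Sum>j\<le>K. smult (\<gamma> j) (bell_poly (N + (K - j))))" for N
    unfolding bell_comb_def by (intro sum.cong) auto
  show "P (real t) \<noteq> 0" if "t > 0" for t using assms(2) that .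
  show "summable (\<lambda>t. real t ^ i * \<bar>P (real t)\<bar> * c ^ t / fact t)" if "c > 0" for c :: real and i
  proof (rule summable_comparison_test'[where N = 0])
    show "summable (\<lambda>t. \<Sum>j\<le>K. \<bar>\<gamma> j\<bar> * (real t ^ (i + (K - j)) * c ^ t / fact t))"
      by (intro summable_sum summable_mult summable_power_div_fact)
    fix t
    have "\<bar>P (real t)\<bar> \<le> (\<Sum>j\<le>K. \<bar>\<gamma> j * real t ^ (K - j)\<bar>)"
      unfolding P_def by (rule sum_abs)
    then have "real t ^ i * \<bar>P (real t)\<bar> * c ^ t / fact t \<le>
        real t ^ i * (\<Sum>j\<le>K. \<bar>\<gamma> j * real t ^ (K - j)\<bar>) * c ^ t / fact t"
      using that by (intro divide_right_mono mult_right_mono mult_left_mono) auto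
    also have "\<dots> = (\<Sum>j\<le>K. \<bar>\<gamma> j\<bar> * (real t ^ (i + (K - j)) * c ^ t / fact t))"
      unfolding power_add
      by (simp add: sum_distrib_left sum_distrib_right sum_divide_distrib abs_mult mult_ac)
    finally show "norm (real t ^ i * \<bar>P (real t)\<bar> * c ^ t / fact t) \<le>
        (\<Sum>j\<le>K. \<bar>\<gamma> j\<bar> * (real t ^ (i + (K - j)) * c ^ t / fact t))"
      using that by simp
  qed
  show "(\<lambda>t. real t ^ N * P (real t) / fact t * x ^ t) sums (exp x * poly (bell_comb K \<gamma> (N + K)) x)" for N x
  proof -
    have "(\<lambda>t. \<Sum>j\<le>K. \<gamma> j * (real t ^ (N + (K - j)) * x ^ t / fact t)) sums
        (\<Sum>j\<le>K. \<gamma> j * (exp x * poly (bell_poly (N + (K - j))) x))"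
      by (intro sums_sum sums_mult Dobinski)
    then show ?thesis
      unfolding power_add
      by (simp add: comb P_def poly_sum sum_distrib_left sum_distrib_right sum_divide_distrib mult_ac)
  qed
  have pderiv_sum: "pderiv (\<Sum>j\<le>K. f j) = (\<Sum>j\<le>K. pderiv (f j))" for f :: "nat \<Rightarrow> real poly"
    by (rule poly_eqI) (simp add: coeff_pderiv coeff_sum sum_distrib_left)
  show "bell_comb K \<gamma> (Suc N + K) = pCons 0 (bell_comb K \<gamma> (N + K) + pderiv (bell_comb K \<gamma> (N + K)))" for N
    unfolding comb pderiv_sum pderiv_smult
  proof (rule poly_eqI)
    show "coeff (\<Sum>j\<le>K. smult (\<gamma> j) (bell_poly (Suc N + (K - j)))) n =
      coeff (pCons 0 ((\<Sum>j\<le>K. smult (\<gamma> j) (bell_poly (N + (K - j)))) +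
        (\<Sum>j\<le>K. smult (\<gamma> j) (pderiv (bell_poly (N + (K - j))))))) n" for n
      by (cases n) (simp_all add: coeff_sum bell_poly_Suc sum.distrib distrib_left)
  qed
qed

text \<open>A polynomial with leading coefficient \<open>\<gamma> 0 = 1\<close> is eventually at
  least 1.\<close>

lemma monic_sum_eventually_pos:
  fixes \<gamma> :: "nat \<Rightarrow> real"
  assumes "\<gamma> 0 = 1"
  shows "\<exists>M>0. \<forall>t>M. (\<Sum>j\<le>K. \<gamma> j * real t ^ (K - j)) > 0"
proof -
  define p where "p = (\<Sum>j\<le>K. monom (\<gamma> j) (K - j))"
  have "coeff p K = (\<Sum>j\<le>K. if j = 0 then \<gamma> j else 0)"
    unfolding p_def coeff_sum by (intro sum.cong) auto
  then have cK: "coeff p K = 1" using assms by simp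
  have "degree p \<le> K"
    unfolding p_def by (intro degree_sum_le) (auto intro: order.trans[OF degree_monom_le])
  moreover have "K \<le> degree p" using cK by (intro le_degree) simp
  ultimately have "lead_coeff p = 1" using cK by simp
  then obtain B where B: "\<And>x. x \<ge> B \<Longrightarrow> poly p x \<ge> 1"
    using poly_pinfty_gt_lc[of p] by auto
  have "(\<Sum>j\<le>K. \<gamma> j * real t ^ (K - j)) > 0" if "t > Suc (nat \<lceil>B\<rceil>)" for t
  proof -
    have "real t \<ge> B" using that by linarith
    then show ?thesis using B[of "real t"] by (simp add: p_def poly_sum poly_monom)
  qed
  then show ?thesis by blast
qed

text \<open>\<open>enumerate\<close> counts from 0, hence \<open>m - 1\<close> in \<open>h\<close>
  and \<open>g\<close>. The exponent is an integer because it is negative for small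
  \<open>n\<close>. The length bound in the last clause ensures that the \<open>m\<close> rightmost
  negative zeros exist.\<close>

theorem theorem4p1:
  fixes K :: nat and \<gamma> :: "nat \<Rightarrow> real"
  fixes p :: "nat \<Rightarrow> real poly" and P :: "real \<Rightarrow> real"
    and H G :: "nat set" and h g :: "nat \<Rightarrow> nat"
  defines "p \<equiv> bell_comb K \<gamma>"
    and "P \<equiv> \<lambda>x. \<Sum>j\<le>K. \<gamma> j * x ^ (K - j)"
    and "H \<equiv> {l. l > 0 \<and> P (real l) * P (real (l + 1)) < 0}"
    and "G \<equiv> {l. l > 0} - H"
    and "h \<equiv> \<lambda>m. enumerate H (m - 1)"
    and "g \<equiv> \<lambda>m. enumerate G (m - 1)"
  assumes "\<gamma> 0 = 1"
    and "\<And>m::nat. m > 0 \<Longrightarrow> P (real m) \<noteq> 0"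
  shows "finite H \<and>
    (\<exists>n0. \<forall>n\<ge>n0. card {x. x > 0 \<and> poly (p n) x = 0} = card H \<and>
      (\<forall>x. x > 0 \<and> poly (p n) x = 0 \<longrightarrow> order x (p n) = 1)) \<and>
    (\<forall>m\<in>{1..card H}.
      (\<lambda>n. pos_zero (p n) m /
           (- (real (h m) * P (real (h m)) / P (real (h m + 1))) *
              (real (h m) / real (h m + 1)) powi (int n - int K - 1))) \<longlonglongrightarrow> 1) \<and>
    (\<forall>m\<ge>1.
      (\<lambda>n. neg_zero (p n) m /
           (- (real (g m) * P (real (g m)) / P (real (g m + 1))) *
              (real (g m) / real (g m + 1)) powi (int n - int K - 1))) \<longlonglongrightarrow> 1) \<and>
    (\<forall>m\<ge>1. \<exists>n0. \<forall>n\<ge>n0. m \<le> length (neg_zeros (p n)) \<and>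
      (\<forall>i\<in>{1..m}. order (neg_zero (p n) i) (p n) = 1))"
proof -
  interpret coefficient_family "\<lambda>t. P (real t)" "\<lambda>N. p (N + K)"
    unfolding p_def P_def by (rule bell_comb_coefficient_family[OF assms(8)[unfolded P_def]])
  obtain M where M: "M > 0" "\<And>t. t > M \<Longrightarrow> P (real t) > 0"
    using monic_sum_eventually_pos[of \<gamma> K] assms(7) unfolding P_def by blast
  have H: "H = {l. l > 0 \<and> 1 * (P (real l) * P (real (Suc l))) < 0}"
    by (simp add: H_def)
  \<comment> \<open>\<open>P\<close> has no zero at positive integers, so a product that is not
    negative is positive; this is the form required for \<open>s = - 1\<close>.\<close>
  have G: "G = {l. l > 0 \<and> - 1 * (P (real l) * P (real (Suc l))) < 0}"
  proof -
    have "\<not> P (real l) * P (real (Suc l)) < 0 \<longleftrightarrow> - 1 * (P (real l) * P (real (Suc l))) < 0" if "l > 0" for l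
    proof -
      have "P (real l) * P (real (Suc l)) \<noteq> 0"
        using P_nz[of l] P_nz[of "Suc l"] that by simp
      then show ?thesis by linarith
    qed
    then show ?thesis unfolding G_def H_def Suc_eq_plus1 by blast
  qed
  have "H \<subseteq> {..M}"
  proof
    fix l assume "l \<in> H"
    then have "\<not> l > M" using M(2)[of l] M(2)[of "Suc l"] by (auto simp: H_def mult_less_0_iff)
    then show "l \<in> {..M}" by simp
  qed
  then have finH: "finite H" using finite_subset by blast
  have infG: "infinite G"
  proof
    assume "finite G"
    then have "finite (G \<union> H \<union> {0})" using finH by simp
    moreover have "G \<union> H \<union> {0} = UNIV" by (auto simp: G_def)
    ultimately show False using infinite_UNIV_nat by metis
  qed
  have shift: "eventually Q sequentially" if "eventually (\<lambda>N. Q (N + K)) sequentially" for Q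
    using that by (simp add: eventually_sequentially_seg)
  have sorted_pos: "sorted_wrt (\<lambda>u v. \<bar>u\<bar> \<le> \<bar>v\<bar>) (pos_zeros q)"
    and mset_pos: "mset (pos_zeros q) = filter_mset (\<lambda>x. 1 * x > 0) (proots q)" for q
  proof -
    show m: "mset (pos_zeros q) = filter_mset (\<lambda>x. 1 * x > 0) (proots q)"
      by (simp add: pos_zeros_def)
    have sgn: "u > 0" if "u \<in> set (pos_zeros q)" for u
      using that arg_cong[OF m, of set_mset] by auto
    show "sorted_wrt (\<lambda>u v. \<bar>u\<bar> \<le> \<bar>v\<bar>) (pos_zeros q)"
    proof (rule sorted_wrt_mono_rel)
      show "sorted (pos_zeros q)" by (simp add: pos_zeros_def)
    qed (use sgn in force)
  qed
  have sorted_neg: "sorted_wrt (\<lambda>u v. \<bar>u\<bar> \<le> \<bar>v\<bar>) (neg_zeros q)"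
    and mset_neg: "mset (neg_zeros q) = filter_mset (\<lambda>x. - 1 * x > 0) (proots q)" for q
  proof -
    show m: "mset (neg_zeros q) = filter_mset (\<lambda>x. - 1 * x > 0) (proots q)"
      by (simp add: neg_zeros_def)
    have sgn: "u < 0" if "u \<in> set (neg_zeros q)" for u
      using that arg_cong[OF m, of set_mset] by auto
    \<comment> \<open>A decreasing list of negative numbers increases in modulus.\<close>
    show "sorted_wrt (\<lambda>u v. \<bar>u\<bar> \<le> \<bar>v\<bar>) (neg_zeros q)"
    proof (rule sorted_wrt_mono_rel)
      show "sorted_wrt (\<ge>) (neg_zeros q)" by (simp add: neg_zeros_def sorted_wrt_rev)
    qed (use sgn in force)
  qed
  have pos: "\<forall>\<^sub>F N in sequentially. k < length (pos_zeros (p (N + K))) \<and>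
      \<bar>pos_zero (p (N + K)) (Suc k) / y (enumerate H k) N - 1\<bar> < e"
    if "k < card H" "0 < e" "e \<le> 1 / 2" for k e
    using signed_zeros[of 1 k e, folded H, OF disjI2[OF that(1)] that(2,3)]
  proof eventually_elim
    case (elim N)
    from elim[rule_format, OF conjI[OF sorted_pos mset_pos]] show ?case
      unfolding pos_zero_def diff_Suc_1 by (elim conjE, intro conjI)
  qed
  have neg: "\<forall>\<^sub>F N in sequentially. k < length (neg_zeros (p (N + K))) \<and>
      \<bar>neg_zero (p (N + K)) (Suc k) / y (enumerate G k) N - 1\<bar> < e \<and>
      order (neg_zero (p (N + K)) (Suc k)) (p (N + K)) = 1"
    if "0 < e" "e \<le> 1 / 2" for k e
    using signed_zeros[of "- 1" k e, folded G, OF disjI1[OF infG] that]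
  proof eventually_elim
    case (elim N)
    from elim[rule_format, OF conjI[OF sorted_neg mset_neg]] show ?case
      unfolding neg_zero_def diff_Suc_1 by (elim conjE, intro conjI)
  qed
  have lim: "(\<lambda>n. f n / (- (real l * P (real l) / P (real (l + 1))) *
      (real l / real (l + 1)) powi (int n - int K - 1))) \<longlonglongrightarrow> 1"
    if l: "l > 0" and f: "\<And>e. 0 < e \<Longrightarrow> e \<le> 1 / 2 \<Longrightarrow> \<forall>\<^sub>F N in sequentially. \<bar>f (N + K) / y l N - 1\<bar> < e"
    for f :: "nat \<Rightarrow> real" and l
  proof (rule tendstoI, rule shift)
    fix e :: real assume "e > 0"
    \<comment> \<open>The exponent is \<open>N - 1\<close>: one factor \<open>l / (l + 1)\<close> is
      spent on turning the \<open>l + 1\<close> of \<open>y_eq\<close> into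
      \<open>l\<close>.\<close>
    have y: "y l N = - (real l * P (real l) / P (real (l + 1))) *
        (real l / real (l + 1)) powi (int (N + K) - int K - 1)" for N
    proof -
      define r where "r = real l / real (l + 1)"
      have "r \<noteq> 0" using l by (simp add: r_def)
      then have "r powi (int (N + K) - int K - 1) = r ^ N / r"
        by (simp add: power_int_diff)
      also have "\<dots> = r ^ N * (real (l + 1) / real l)" by (simp add: r_def)
      finally show ?thesis
        unfolding y_eq[OF l] r_def[symmetric] using l by simp
    qed
    have "\<forall>\<^sub>F N in sequentially. \<bar>f (N + K) / y l N - 1\<bar> < min e (1 / 2)"
      using \<open>e > 0\<close> by (intro f) auto
    then show "\<forall>\<^sub>F N in sequentially. dist (f (N + K) / (- (real l * P (real l) / P (real (l + 1))) *
        (real l / real (l + 1)) powi (int (N + K) - int K - 1))) 1 < e"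
      unfolding y[symmetric] dist_real_def by (rule eventually_mono) auto
  qed
  have count: "\<exists>n0. \<forall>n\<ge>n0. card {x. x > 0 \<and> poly (p n) x = 0} = card H \<and>
      (\<forall>x. x > 0 \<and> poly (p n) x = 0 \<longrightarrow> order x (p n) = 1)"
    unfolding H mult_1 eventually_sequentially[symmetric]
    by (rule shift, rule positive_zeros[OF M(2,1)])
  have pos_lim: "(\<lambda>n. pos_zero (p n) m /
           (- (real (h m) * P (real (h m)) / P (real (h m + 1))) *
              (real (h m) / real (h m + 1)) powi (int n - int K - 1))) \<longlonglongrightarrow> 1" if m: "m \<in> {1..card H}" for m
  proof (rule lim)
    have k: "m - 1 < card H" "Suc (m - 1) = m" using m by auto
    show "h m > 0" using enumerate_rank(1)[of H "m - 1"] k by (auto simp: h_def H_def)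
    show "\<forall>\<^sub>F N in sequentially. \<bar>pos_zero (p (N + K)) m / y (h m) N - 1\<bar> < e" if "0 < e" "e \<le> 1 / 2" for e
      using pos[OF k(1) that] unfolding k(2) h_def by (rule eventually_mono) simp
  qed
  have neg_lim: "(\<lambda>n. neg_zero (p n) m /
           (- (real (g m) * P (real (g m)) / P (real (g m + 1))) *
              (real (g m) / real (g m + 1)) powi (int n - int K - 1))) \<longlonglongrightarrow> 1" if m: "m \<ge> 1" for m
  proof (rule lim)
    have k: "Suc (m - 1) = m" using m by auto
    show "g m > 0" using enumerate_rank(1)[of G "m - 1"] infG by (auto simp: g_def G_def)
    show "\<forall>\<^sub>F N in sequentially. \<bar>neg_zero (p (N + K)) m / y (g m) N - 1\<bar> < e" if "0 < e" "e \<le> 1 / 2" for e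
      using neg[OF that, of "m - 1"] unfolding k g_def by (rule eventually_mono) simp
  qed
  have neg_simple: "\<exists>n0. \<forall>n\<ge>n0. m \<le> length (neg_zeros (p n)) \<and>
      (\<forall>i\<in>{1..m}. order (neg_zero (p n) i) (p n) = 1)" for m
  proof -
    have "\<forall>\<^sub>F N in sequentially. \<forall>k\<in>{..<m}. k < length (neg_zeros (p (N + K))) \<and>
      order (neg_zero (p (N + K)) (Suc k)) (p (N + K)) = 1"
      by (intro eventually_ball_finite ballI eventually_mono[OF neg[of "1 / 2"]]) auto
    then have "\<forall>\<^sub>F n in sequentially. \<forall>k\<in>{..<m}. k < length (neg_zeros (p n)) \<and>
      order (neg_zero (p n) (Suc k)) (p n) = 1"
      by (rule shift)
    then have "\<forall>\<^sub>F n in sequentially. m \<le> length (neg_zeros (p n)) \<and>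
      (\<forall>i\<in>{1..m}. order (neg_zero (p n) i) (p n) = 1)"
    proof (rule eventually_mono, intro conjI ballI)
      fix n i assume *: "\<forall>k\<in>{..<m}. k < length (neg_zeros (p n)) \<and> order (neg_zero (p n) (Suc k)) (p n) = 1"
      \<comment> \<open>If the list were shorter than \<open>m\<close>, its length would itself be
        an admissible \<open>k\<close>, which is absurd.\<close>
      show "m \<le> length (neg_zeros (p n))"
        using bspec[OF *, of "length (neg_zeros (p n))"] by force
      show "order (neg_zero (p n) i) (p n) = 1" if "i \<in> {1..m}"
      proof -
        have "i - 1 \<in> {..<m}" "Suc (i - 1) = i" using that by auto
        then show ?thesis using bspec[OF *, of "i - 1"] by simp
      qed
    qed
    then show ?thesis by (simp add: eventually_sequentially)
  qed
  show ?thesis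
    by (intro conjI ballI allI impI finH count pos_lim neg_lim neg_simple)
qed

end
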